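(* The map from $M_2(\mathrm{SL}_2(\mathbb{Z}))$ to $Eq$ given by $$f\longmapsto M_{(1,\tau)}f,\qquad (M_{(1,\tau)}f)(\tau)=\frac{\tau f(\tau)+\eta(\tau)}{f(\tau)+\eta(1)},$$ is a bijection. The inverse map is given by $h\longmapsto M_{(1,\tau)}^{-1}h$.
   Context: $\mathbb{H}$ is the upper half-plane. For $\gamma=\begin{bmatrix}a&b\\c&d\end{bmatrix}\in\mathrm{GL}_2(\mathbb{C})$ and a function $f$ on $\mathbb{H}$, $\gamma f(\tau)=\frac{af(\tau)+b}{cf(\tau)+d}$; the same formula defines $\gamma\tau$. This is applied pointwise in $\tau$ to the matrix $$M_{(1,\tau)}=\begin{bmatrix}\tau&\eta(\tau)\\1&\eta(1)\end{bmatrix},$$ which is invertible for each $\tau\in\mathbb{H}$ by the Legendre relation. Here $\eta=\eta_{\Lambda_\tau}$ is the quasi-period map of the Weierstrass zeta function of $\Lambda_\tau=\mathbb{Z}+\tau\mathbb{Z}$: with $\zeta(\Lambda,z)=\frac1z+\sum_{\omega\in\Lambda,\,\omega\ne0}\left(\frac{1}{z-\omega}+\frac1\omega+\frac{z}{\omega^2}\right)$, $\eta_\Lambda(\omega)$ is defined by $\zeta(\Lambda,z+\omega)=\zeta(\Lambda,z)+\eta_\Lambda(\omega)$ for $\omega\in\Lambda$. $M_2(\mathrm{SL}_2(\mathbb{Z}))$ is the space of meromorphic functions $f$ on $\mathbb{H}$ with $f(\gamma\tau)=(c\tau+d)^2f(\tau)$ for all $\gamma=\begin{bmatrix}a&b\\c&d\end{bmatrix}\in\mathrm{SL}_2(\mathbb{Z})$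 (no condition at the cusp is imposed here). $Eq$ is the set of all meromorphic functions $h$ on $\mathbb{H}$ with $h(\gamma\tau)=\gamma h(\tau)$ for all $\gamma\in\mathrm{SL}_2(\mathbb{Z})$, $\tau\in\mathbb{H}$ (equivariant functions), excluding the trivial one $h(\tau)=\tau$. *)

theory Defs
  imports "HOL-Complex_Analysis.Complex_Analysis"
begin

(* otherwise $ is ambiguous between vec_nth and fps_nth *)
unbundle no fps_syntax

definition uhp :: "complex set" where
  "uhp = {\<tau>. Im \<tau> > 0}"

definition SL2Z :: "(int^2^2) set" where
  "SL2Z = {\<gamma>. det \<gamma> = 1}"

abbreviation point_act :: "complex^2^2 \<Rightarrow> complex \<Rightarrow> complex" where
  "point_act A z \<equiv> moebius (A$1$1) (A$1$2) (A$2$1) (A$2$2) z"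

text \<open>
  The Riemann sphere is represented by \<^typ>\<open>complex option\<close>, with \<^term>\<open>None\<close> as the point at
  infinity.
\<close>

definition sphere_act :: "complex^2^2 \<Rightarrow> complex option \<Rightarrow> complex option" where
  "sphere_act A w =
     (case w of
        None \<Rightarrow> (if A$2$1 = 0 then None else Some (A$1$1 / A$2$1))
      | Some z \<Rightarrow> (if A$2$1 * z + A$2$2 = 0 then None
                  else Some (point_act A z)))"

text \<open>
  A meromorphic function on the upper half-plane is taken as a map to the sphere, with value
  infinity exactly at its poles, so that equality is pointwise equality and every functional
  equation below is meant at all points, poles included.  The constant function infinity is not
  meromorphic.  The predicate \<^const>\<open>nicely_meromorphic_on\<close> only serves to rule out wrong values
  at removable singularities; outside the half-plane the value is \<^const>\<open>undefined\<close>.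
\<close>

definition sphere_fun :: "(complex \<Rightarrow> complex) \<Rightarrow> complex \<Rightarrow> complex option" where
  "sphere_fun g = (\<lambda>\<tau>\<in>uhp. if is_pole g \<tau> then None else Some (g \<tau>))"

definition mero_uhp :: "(complex \<Rightarrow> complex option) set" where
  "mero_uhp = {sphere_fun g | g. g nicely_meromorphic_on uhp}"

definition M2_SL2Z :: "(complex \<Rightarrow> complex option) set" where
  "M2_SL2Z = {f \<in> mero_uhp. \<forall>\<gamma>\<in>SL2Z. \<forall>\<tau>\<in>uhp.
     f (point_act (map_matrix of_int \<gamma>) \<tau>) =
     map_option (\<lambda>w. (of_int (\<gamma>$2$1) * \<tau> + of_int (\<gamma>$2$2))^2 * w) (f \<tau>)}"

definition equivariant_funs :: "(complex \<Rightarrow> complex option) set" where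
  "equivariant_funs = {h \<in> mero_uhp.
     (\<forall>\<gamma>\<in>SL2Z. \<forall>\<tau>\<in>uhp.
        h (point_act (map_matrix of_int \<gamma>) \<tau>) = sphere_act (map_matrix of_int \<gamma>) (h \<tau>)) \<and>
     h \<noteq> (\<lambda>\<tau>\<in>uhp. Some \<tau>)}"

definition period_lattice :: "complex \<Rightarrow> complex set" where
  "period_lattice \<tau> = {of_int m + of_int n * \<tau> | m n. True}"

definition weierstrass_zeta :: "complex set \<Rightarrow> complex \<Rightarrow> complex" where
  "weierstrass_zeta \<Lambda> z =
     1 / z + (\<Sum>\<^sub>\<infinity>\<omega>\<in>\<Lambda> - {0}. 1 / (z - \<omega>) + 1 / \<omega> + z / \<omega>^2)"

text \<open>
  The points of the lattice are the poles of zeta, where \<^const>\<open>weierstrass_zeta\<close> has a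
  meaningless value because of division by zero.
\<close>

definition quasi_period :: "complex set \<Rightarrow> complex \<Rightarrow> complex" where
  "quasi_period \<Lambda> \<omega> =
     (THE e. \<forall>z. z \<notin> \<Lambda> \<longrightarrow> weierstrass_zeta \<Lambda> (z + \<omega>) = weierstrass_zeta \<Lambda> z + e)"

definition M_mat :: "complex \<Rightarrow> complex^2^2" where
  "M_mat \<tau> = vector [vector [\<tau>, quasi_period (period_lattice \<tau>) \<tau>],
                     vector [1, quasi_period (period_lattice \<tau>) 1]]"

definition M_map :: "(complex \<Rightarrow> complex option) \<Rightarrow> complex \<Rightarrow> complex option" where
  "M_map f = (\<lambda>\<tau>\<in>uhp. sphere_act (M_mat \<tau>) (f \<tau>))"

definition M_inv_map :: "(complex \<Rightarrow> complex option) \<Rightarrow> complex \<Rightarrow> complex option" where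
  "M_inv_map h = (\<lambda>\<tau>\<in>uhp. sphere_act (matrix_inv (M_mat \<tau>)) (h \<tau>))"

end

(*
  Summed along rows m + n tau (n fixed), the zeta series becomes
    zeta(z) = sum over n of (pi cot(pi (z - n tau)) + pi cot(pi n tau) + z s_n),
  s_n being the sum of 1/(m + n tau)^2 over m.  Periodicity of the cotangent gives eta(1) = sum s_n;
  shifting z by tau telescopes, and cot -> -i, +i at the two ends of the imaginary axis gives the
  Legendre relation eta(tau) = tau eta(1) - 2 pi i.  Hence M(tau) is invertible, and it is holomorphic
  in tau because eta(1) = zeta(1/2) - zeta(-1/2).

  Homogeneity of eta yields M(g tau) diag(j, 1/j) = g M(tau) with j = c tau + d, and diag(j, 1/j)
  acts as multiplication by j^2: so f has weight 2 iff M f is equivariant.  The excluded functions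
  correspond, since M(tau) sends infinity to tau, and M f is never constantly infinity because
  tau -> -1/tau moves infinity to 0.
*)
theory Submission
  imports Defs
begin

section \<open>Summability over the lattice\<close>

text \<open>The first obstacle is conditional convergence. The double series of
  \<open>1 / \<omega>^2\<close> over the lattice is not absolutely convergent, whereas the complete
  zeta terms decay cubically. So absolute convergence is secured for the complete terms, and only
  then is each row cut into cotangents and s_n. Convergence of the sum of the s_n is not estimated:
  it is inherited from the row expansions at z + 1 and z, whose difference it is.

  Since \<open>quasi_period\<close> is a definite description, the laws of eta are first proved for
  the relation \<open>is_quasi_period\<close> and passed on by uniqueness, which can be tested at
  one point off the lattice, such as 1/2.

  The second obstacle is that functions are compared at poles too. A Moebius transform with
  holomorphic coefficients must take the right value on the sphere at every point. The naive
  quotient may be wrong at isolated points, so its values are replaced by its limits, and the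
  identity theorem excludes a denominator that vanishes identically.\<close>

lemma summable_on_int_powr:
  fixes s :: real
  assumes "s > 1"
  shows "(\<lambda>m::int. (1 + \<bar>of_int m\<bar>) powr -s) summable_on UNIV"
proof -
  let ?f = "\<lambda>m::int. (1 + \<bar>of_int m\<bar>) powr -s :: real"
  have nat: "(\<lambda>n::nat. (1 + real n) powr -s) summable_on UNIV"
  proof -
    have "summable (\<lambda>n. real n powr -s)"
      using assms by (simp add: summable_real_powr_iff)
    hence "summable (\<lambda>n. real (Suc n) powr -s)"
      by (subst summable_Suc_iff)
    thus ?thesis
      by (subst summable_on_UNIV_nonneg_real_iff) (simp_all add: add.commute)
  qed
  have 1: "?f summable_on {0..}"
    using nat by (subst summable_on_reindex_bij_witness[where j = nat and i = int and T = UNIV and h = "\<lambda>n. (1 + real n) powr -s"]) auto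
  have 2: "?f summable_on {..0}"
    using nat by (subst summable_on_reindex_bij_witness[where j = "\<lambda>m. nat (-m)" and i = "\<lambda>n. - int n" and T = UNIV and h = "\<lambda>n. (1 + real n) powr -s"]) auto
  have "?f summable_on ({0..} \<union> ({..0} - {0}))"
    by (intro summable_on_Un_disjoint 1 summable_on_cofin_subset 2) auto
  also have "{0..} \<union> ({..0} - {0}) = (UNIV :: int set)"
    by auto
  finally show ?thesis .
qed

text \<open>The cubic decay is shared equally by the two indices, 3 = 3/2 + 3/2. As 3/2 > 1, the
  double sum factors into two convergent ones.\<close>

definition pair_weight :: "int \<times> int \<Rightarrow> real" where
  "pair_weight = (\<lambda>(n,m). (1 + \<bar>of_int n\<bar>) powr (-3/2) * (1 + \<bar>of_int m\<bar>) powr (-3/2))"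

lemma summable_pair_weight: "pair_weight summable_on UNIV"
proof -
  let ?p = "\<lambda>m::int. (1 + \<bar>of_int m\<bar>) powr (-3/2) :: real"
  have p: "?p summable_on UNIV"
    using summable_on_int_powr[of "3/2"] by simp
  have "pair_weight summable_on Sigma UNIV (\<lambda>_. UNIV)"
  proof (rule summable_on_SigmaI)
    show "((\<lambda>m. pair_weight (n, m)) has_sum ?p n * infsum ?p UNIV) UNIV" for n
      by (simp only: pair_weight_def case_prod_conv) (intro has_sum_cmult_right has_sum_infsum p)
    show "(\<lambda>n. ?p n * infsum ?p UNIV) summable_on UNIV"
      by (intro summable_on_cmult_left p)
  qed (auto simp: pair_weight_def)
  thus ?thesis by simp
qed

text \<open>For a nonzero integer pair the sum of absolute values is at least 1, so
  \<open>1 + a\<close> and \<open>1 + b\<close> are both at most \<open>2 * (a + b)\<close>. The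
  3/2-th power of the product of these bounds is \<open>(2 * (a + b)) ^ 3\<close>, whence the
  8.\<close>

lemma cubic_decay_le_pair_weight:
  assumes "(n, m) \<noteq> (0, 0 :: int)"
  shows "1 / (\<bar>of_int n\<bar> + \<bar>of_int m\<bar>) ^ 3 \<le> 8 * pair_weight (n, m)"
proof -
  define a where "a = \<bar>real_of_int n\<bar>"
  define b where "b = \<bar>real_of_int m\<bar>"
  have ab: "a + b \<ge> 1" "a \<ge> 0" "b \<ge> 0"
    using assms unfolding a_def b_def by (auto simp flip: of_int_abs of_int_add)
  have "(1 + a) * (1 + b) \<le> (2 * (a + b)) * (2 * (a + b))"
    using ab by (intro mult_mono) auto
  hence "((1 + a) * (1 + b)) powr (3/2) \<le> ((2 * (a + b)) ^ 2) powr (3/2)"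
    using ab by (intro powr_mono2) (auto simp: power2_eq_square)
  also have "(2 * (a + b)) ^ 2 = (2 * (a + b)) powr 2"
    using ab by (intro powr_numeral [symmetric]) auto
  also have "(\<dots>) powr (3/2) = (2 * (a + b)) powr 3"
    unfolding powr_powr by simp
  also have "\<dots> = (2 * (a + b)) ^ 3"
    using ab by (intro powr_numeral) auto
  also have "\<dots> = 8 * (a + b) ^ 3"
    by (simp only: power_mult_distrib) simp
  finally have *: "(1 + a) powr (3/2) * (1 + b) powr (3/2) \<le> 8 * (a + b) ^ 3"
    using ab by (simp add: powr_mult)
  have "1 / (a + b) ^ 3 = 8 / (8 * (a + b) ^ 3)"
    by simp
  also have "\<dots> \<le> 8 / ((1 + a) powr (3/2) * (1 + b) powr (3/2))"
    using ab * by (intro divide_left_mono) auto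
  also have "\<dots> = 8 * pair_weight (n, m)"
    by (simp add: pair_weight_def a_def b_def powr_minus divide_simps)
  finally show ?thesis by (simp add: a_def b_def)
qed

text \<open>
  For \<^term>\<open>\<omega> = 0\<close> the convention \<^term>\<open>1 / 0 = 0\<close> leaves exactly the polar term \<^term>\<open>1 / z\<close>, so
  the zeta function is the sum of these terms over the whole lattice.
\<close>

definition zeta_term :: "complex \<Rightarrow> complex \<Rightarrow> complex" where
  "zeta_term z \<omega> = 1 / (z - \<omega>) + 1 / \<omega> + z / \<omega>^2"

text \<open>The three fractions combine to \<open>z^2 / (\<omega>^2 * (z - \<omega>))\<close>. For
  \<open>\<omega>\<close> this large, \<open>z - \<omega>\<close> has at least half the norm of
  \<open>\<omega>\<close>.\<close>

lemma norm_zeta_term_le: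
  assumes "\<omega> \<noteq> 0" "norm \<omega> \<ge> 2 * norm z"
  shows "norm (zeta_term z \<omega>) \<le> 2 * norm z ^ 2 / norm \<omega> ^ 3"
proof -
  have "norm (z - \<omega>) \<ge> norm \<omega> - norm z"
    by (metis norm_minus_commute norm_triangle_ineq2)
  with assms have d: "norm (z - \<omega>) \<ge> norm \<omega> / 2" by simp
  hence ne: "z - \<omega> \<noteq> 0" using assms by auto
  have "zeta_term z \<omega> = z^2 / (\<omega>^2 * (z - \<omega>))"
    using ne assms by (simp add: zeta_term_def divide_simps) (simp add: algebra_simps power2_eq_square)
  also have "norm \<dots> = norm z ^ 2 / (norm \<omega> ^ 2 * norm (z - \<omega>))"
    by (simp add: norm_divide norm_mult norm_power)
  also have "\<dots> \<le> norm z ^ 2 / (norm \<omega> ^ 2 * (norm \<omega> / 2))"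
    using d assms ne by (intro divide_left_mono mult_left_mono) auto
  also have "\<dots> = 2 * norm z ^ 2 / norm \<omega> ^ 3"
    by (simp add: power2_eq_square power3_eq_cube)
  finally show ?thesis .
qed

text \<open>The coefficient of \<open>\<tau>\<close> is the first index, so that the fibres of a sum
  over pairs are the rows of the lattice.\<close>

definition lattice_pt :: "complex \<Rightarrow> int \<times> int \<Rightarrow> complex" where
  "lattice_pt \<tau> = (\<lambda>(n,m). of_int m + of_int n * \<tau>)"

lemma lattice_pt_eq_0_iff: "Im \<tau> > 0 \<Longrightarrow> lattice_pt \<tau> p = 0 \<longleftrightarrow> p = (0, 0)"
  by (cases p) (auto simp: lattice_pt_def complex_eq_iff)

lemma inj_lattice_pt: "Im \<tau> > 0 \<Longrightarrow> inj (lattice_pt \<tau>)"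
  by (auto simp: inj_on_def lattice_pt_def complex_eq_iff)

lemma range_lattice_pt: "range (lattice_pt \<tau>) = period_lattice \<tau>"
  by (auto simp: lattice_pt_def period_lattice_def)

text \<open>The imaginary part controls n, and then m is the lattice point minus
  \<open>n * \<tau>\<close>. The constant depends only on \<open>\<delta>\<close> and
  \<open>B\<close>, hence is uniform for \<open>\<tau>\<close> in compact sets.\<close>

lemma norm_lattice_pt_ge:
  assumes "Im \<tau> \<ge> \<delta>" "\<delta> > 0" "norm \<tau> \<le> B"
  shows "\<bar>of_int n\<bar> + \<bar>of_int m\<bar> \<le> (1 + (1 + B) / \<delta>) * norm (lattice_pt \<tau> (n,m))"
proof -
  let ?w = "lattice_pt \<tau> (n,m)"
  have B: "B \<ge> 0" using assms(3) norm_ge_zero order_trans by blast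
  have "\<bar>of_int n\<bar> * \<delta> \<le> \<bar>of_int n\<bar> * Im \<tau>"
    using assms by (intro mult_left_mono) auto
  also have "\<dots> = \<bar>Im ?w\<bar>"
    using assms by (simp add: lattice_pt_def abs_mult)
  also have "\<dots> \<le> norm ?w" by (rule abs_Im_le_cmod)
  finally have n: "\<bar>of_int n\<bar> \<le> norm ?w / \<delta>"
    using assms by (simp add: field_simps)
  have "\<bar>real_of_int m\<bar> = norm (?w - of_int n * \<tau>)"
    by (simp add: lattice_pt_def)
  also have "\<dots> \<le> norm ?w + norm (of_int n * \<tau>)" by (rule norm_triangle_ineq4)
  also have "norm (of_int n * \<tau>) \<le> (norm ?w / \<delta>) * B"
    unfolding norm_mult using n assms B by (intro mult_mono) auto
  finally show ?thesis using n by (simp add: algebra_simps add_divide_distrib)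
qed

lemma finite_index_box: "finite {(n::int, m::int). \<bar>real_of_int n\<bar> + \<bar>real_of_int m\<bar> \<le> K}"
proof (rule finite_subset)
  show "{(n::int, m::int). \<bar>real_of_int n\<bar> + \<bar>real_of_int m\<bar> \<le> K}
         \<subseteq> {-\<lceil>K\<rceil>..\<lceil>K\<rceil>} \<times> {-\<lceil>K\<rceil>..\<lceil>K\<rceil>}"
  proof safe
    fix n m :: int assume "\<bar>real_of_int n\<bar> + \<bar>real_of_int m\<bar> \<le> K"
    hence "\<bar>real_of_int n\<bar> \<le> K" "\<bar>real_of_int m\<bar> \<le> K" by linarith+
    thus "n \<in> {-\<lceil>K\<rceil>..\<lceil>K\<rceil>}" "m \<in> {-\<lceil>K\<rceil>..\<lceil>K\<rceil>}"
      by (simp_all; linarith)+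
  qed
qed auto

text \<open>Outside a finite box of indices the lattice point has norm at least
  \<open>2 * norm z\<close>, and the two previous bounds multiply to 16 = 2 * 8. As the right-hand
  side is free of \<open>\<tau>\<close>, it gives both summability at fixed \<open>\<tau>\<close>
  and locally uniform convergence.\<close>

lemma norm_zeta_term_lattice_pt_le:
  assumes "Im \<tau> \<ge> \<delta>" "\<delta> > 0" "norm \<tau> \<le> B"
  defines "C \<equiv> 1 + (1 + B) / \<delta>"
  assumes "\<bar>of_int n\<bar> + \<bar>of_int m\<bar> > 2 * norm z * C"
  shows "norm (zeta_term z (lattice_pt \<tau> (n,m))) \<le> 16 * norm z ^ 2 * C ^ 3 * pair_weight (n,m)"
proof -
  let ?s = "\<bar>real_of_int n\<bar> + \<bar>real_of_int m\<bar>" and ?w = "lattice_pt \<tau> (n,m)"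
  have B: "B \<ge> 0" using assms(3) norm_ge_zero order_trans by blast
  have C: "C > 0" using assms(2) B by (simp add: C_def add_pos_nonneg)
  have s: "?s > 0" using assms(5) C by (smt (verit) mult_nonneg_nonneg norm_ge_zero)
  have sw: "?s \<le> C * norm ?w"
    unfolding C_def by (rule norm_lattice_pt_ge) fact+
  have w: "?s / C \<le> norm ?w" using sw C by (simp add: field_simps)
  have w0: "?w \<noteq> 0" using sw s by auto
  have "2 * norm z * C < C * norm ?w" using assms(5) sw by linarith
  hence "2 * norm z \<le> norm ?w" using C by (simp add: mult.commute)
  hence "norm (zeta_term z ?w) \<le> 2 * norm z ^ 2 / norm ?w ^ 3"
    by (intro norm_zeta_term_le w0)
  also have "\<dots> \<le> 2 * norm z ^ 2 / (?s / C) ^ 3"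
    using w s C w0 by (intro divide_left_mono power_mono mult_pos_pos zero_less_power) (auto)
  also have "\<dots> = 2 * norm z ^ 2 * C ^ 3 * (1 / ?s ^ 3)"
    by (simp add: power_divide)
  also have "\<dots> \<le> 2 * norm z ^ 2 * C ^ 3 * (8 * pair_weight (n,m))"
    using s C by (intro mult_left_mono cubic_decay_le_pair_weight) auto
  finally show ?thesis by simp
qed

lemma summable_zeta_term:
  assumes "Im \<tau> > 0"
  shows "(\<lambda>p. zeta_term z (lattice_pt \<tau> p)) summable_on A"
proof -
  define C where "C = 1 + (1 + norm \<tau>) / Im \<tau>"
  define F where "F = {(n::int, m::int). \<bar>real_of_int n\<bar> + \<bar>real_of_int m\<bar> \<le> 2 * norm z * C}"
  have fin: "finite F" unfolding F_def by (rule finite_index_box)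
  have "(\<lambda>p. norm (zeta_term z (lattice_pt \<tau> p))) summable_on -F"
  proof (rule Infinite_Sum.abs_summable_on_comparison_test')
    show "(\<lambda>p. 16 * norm z ^ 2 * C ^ 3 * pair_weight p) summable_on -F"
      by (intro summable_on_cmult_right summable_on_subset[OF summable_pair_weight]) auto
    show "norm (zeta_term z (lattice_pt \<tau> p)) \<le> 16 * norm z ^ 2 * C ^ 3 * pair_weight p" if "p \<in> -F" for p
      using that norm_zeta_term_lattice_pt_le[of "Im \<tau>" \<tau> "norm \<tau>" z "fst p" "snd p"] assms
      by (cases p) (auto simp: F_def C_def)
  qed
  \<comment> \<open>All indices with a vanishing denominator lie in the finite box \<open>F\<close>,
    which may be added back freely.\<close>
  hence "(\<lambda>p. zeta_term z (lattice_pt \<tau> p)) summable_on (-F \<union> F)"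
    using fin by (intro summable_on_Un_disjoint) (auto intro: abs_summable_summable)
  thus ?thesis by (rule summable_on_subset) auto
qed

lemma weierstrass_zeta_eq_infsum:
  assumes "Im \<tau> > 0"
  shows "weierstrass_zeta (period_lattice \<tau>) z = (\<Sum>\<^sub>\<infinity>p. zeta_term z (lattice_pt \<tau> p))"
proof -
  have eq: "period_lattice \<tau> - {0} = lattice_pt \<tau> ` (-{(0,0)})"
    using lattice_pt_eq_0_iff[OF assms] by (auto simp flip: range_lattice_pt)
  have "weierstrass_zeta (period_lattice \<tau>) z =
      1 / z + (\<Sum>\<^sub>\<infinity>p\<in>-{(0,0)}. zeta_term z (lattice_pt \<tau> p))"
    unfolding weierstrass_zeta_def eq
    by (subst infsum_reindex) (auto intro: inj_on_subset[OF inj_lattice_pt[OF assms]]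
          simp: o_def zeta_term_def)
  also have "1 / z = zeta_term z (lattice_pt \<tau> (0,0))"
    by (simp add: zeta_term_def lattice_pt_def)
  also have "\<dots> + (\<Sum>\<^sub>\<infinity>p\<in>-{(0,0)}. zeta_term z (lattice_pt \<tau> p)) =
     (\<Sum>\<^sub>\<infinity>p\<in>insert (0,0) (-{(0,0)}). zeta_term z (lattice_pt \<tau> p))"
    by (subst infsum_insert) (auto intro: summable_zeta_term assms)
  also have "insert (0,0) (-{(0,0)}) = (UNIV :: (int\<times>int) set)" by auto
  finally show ?thesis .
qed

section \<open>Holomorphy of the zeta function in the lattice parameter\<close>

text \<open>The error of a finite partial sum is at most the tail of \<open>M\<close>, uniformly in
  the point. The filter of finite subsets is kept, since the limit theorem for holomorphic functions
  accepts it directly.\<close>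

lemma Weierstrass_m_test_infsum:
  fixes f :: "'i \<Rightarrow> 'a \<Rightarrow> 'b :: banach"
  assumes bound: "\<And>i x. i \<in> I \<Longrightarrow> x \<in> X \<Longrightarrow> norm (f i x) \<le> M i"
    and M: "M summable_on I"
  shows "uniform_limit X (\<lambda>F x. \<Sum>i\<in>F. f i x) (\<lambda>x. \<Sum>\<^sub>\<infinity>i\<in>I. f i x) (finite_subsets_at_top I)"
proof (rule uniform_limitI)
  fix e :: real assume e: "e > 0"
  have sumf: "(\<lambda>i. norm (f i x)) summable_on J" if "x \<in> X" "J \<subseteq> I" for x J
    by (rule Infinite_Sum.abs_summable_on_comparison_test'[OF summable_on_subset[OF M that(2)]])
       (use that bound in auto)
  have "(M has_sum infsum M I) I" using M by (rule has_sum_infsum)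
  hence "(sum M \<longlongrightarrow> infsum M I) (finite_subsets_at_top I)" by (simp add: has_sum_def)
  hence ev: "eventually (\<lambda>F. dist (sum M F) (infsum M I) < e) (finite_subsets_at_top I)"
    using e by (simp add: tendsto_iff)
  have ev2: "eventually (\<lambda>F. finite F \<and> F \<subseteq> I) (finite_subsets_at_top I)"
    by (rule eventually_finite_subsets_at_top_weakI) auto
  show "eventually (\<lambda>F. \<forall>x\<in>X. dist (\<Sum>i\<in>F. f i x) (\<Sum>\<^sub>\<infinity>i\<in>I. f i x) < e) (finite_subsets_at_top I)"
    using ev ev2
  proof eventually_elim
    case (elim F)
    show ?case
    proof
      fix x assume x: "x \<in> X"
      have "infsum (\<lambda>i. f i x) I - infsum (\<lambda>i. f i x) F = infsum (\<lambda>i. f i x) (I - F)"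
        using elim x by (subst infsum_Diff) (auto intro: abs_summable_summable sumf)
      hence "dist (\<Sum>i\<in>F. f i x) (\<Sum>\<^sub>\<infinity>i\<in>I. f i x) = norm (infsum (\<lambda>i. f i x) (I - F))"
        using elim by (metis dist_commute dist_norm infsum_finite)
      also have "\<dots> \<le> infsum (\<lambda>i. norm (f i x)) (I - F)"
        by (rule norm_infsum_bound) (use sumf[OF x, of "I - F"] in auto)
      also have "\<dots> \<le> infsum M (I - F)"
        using elim bound x
        by (intro infsum_mono sumf summable_on_cofin_subset M) auto
      also have "\<dots> = infsum M I - sum M F"
        using elim by (subst infsum_Diff) (auto intro: M)
      also have "\<dots> < e" using elim by (auto simp: dist_real_def)
      finally show "dist (\<Sum>i\<in>F. f i x) (\<Sum>\<^sub>\<infinity>i\<in>I. f i x) < e" .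
    qed
  qed
qed

lemma open_uhp: "open uhp"
  unfolding uhp_def by (rule open_halfspace_Im_gt)

text \<open>A locally uniform limit of holomorphic terms. Only real non-integers satisfy the
  hypothesis: for non-real \<open>z\<close>, one of \<open>z\<close> and \<open>-z\<close> is itself
  a point \<open>\<tau>\<close> of the half-plane. This is why eta(1) is read off at 1/2 and
  -1/2.\<close>

lemma holomorphic_zeta_in_tau:
  assumes z: "\<And>\<tau>. \<tau> \<in> uhp \<Longrightarrow> z \<notin> period_lattice \<tau>"
  shows "(\<lambda>\<tau>. weierstrass_zeta (period_lattice \<tau>) z) holomorphic_on uhp"
proof -
  have ht: "(\<lambda>\<tau>. zeta_term z (lattice_pt \<tau> p)) holomorphic_on uhp" for p
  proof (cases "p = (0,0)")
    case False
    have "z - lattice_pt \<tau> p \<noteq> 0" "lattice_pt \<tau> p \<noteq> 0" if "\<tau> \<in> uhp" for \<tau>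
      using False z[OF that] that by (auto simp: lattice_pt_eq_0_iff uhp_def simp flip: range_lattice_pt)
    thus ?thesis
      by (cases p) (auto intro!: holomorphic_intros simp: zeta_term_def lattice_pt_def)
  qed (simp add: zeta_term_def lattice_pt_def)
  have "(\<lambda>\<tau>. weierstrass_zeta (period_lattice \<tau>) z) field_differentiable (at \<tau>0)" if t0: "\<tau>0 \<in> uhp" for \<tau>0
  proof -
    \<comment> \<open>Half the height, so that the imaginary part stays at least \<open>r\<close> on
      the closed disc.\<close>
    define r where "r = Im \<tau>0 / 2"
    have r: "r > 0" using t0 by (simp add: r_def uhp_def)
    have K: "Im \<tau> \<ge> r" "norm \<tau> \<le> norm \<tau>0 + r" if "\<tau> \<in> cball \<tau>0 r" for \<tau>
    proof -
      have "norm (\<tau>0 - \<tau>) \<le> r" using that by (simp add: dist_norm)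
      moreover have "\<bar>Im (\<tau>0 - \<tau>)\<bar> \<le> norm (\<tau>0 - \<tau>)" by (rule abs_Im_le_cmod)
      moreover have "norm \<tau> \<le> norm \<tau>0 + norm (\<tau>0 - \<tau>)"
        by (metis norm_minus_commute norm_triangle_sub)
      ultimately show "Im \<tau> \<ge> r" "norm \<tau> \<le> norm \<tau>0 + r" by (auto simp: r_def)
    qed
    have sub: "cball \<tau>0 r \<subseteq> uhp" using K(1) r by (force simp: uhp_def)
    define C where "C = 1 + (1 + (norm \<tau>0 + r)) / r"
    define F where "F = {(n::int, m::int). \<bar>real_of_int n\<bar> + \<bar>real_of_int m\<bar> \<le> 2 * norm z * C}"
    have fin: "finite F" unfolding F_def by (rule finite_index_box)
    have ul: "uniform_limit (cball \<tau>0 r) (\<lambda>G \<tau>. \<Sum>p\<in>G. zeta_term z (lattice_pt \<tau> p))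
        (\<lambda>\<tau>. \<Sum>\<^sub>\<infinity>p\<in>-F. zeta_term z (lattice_pt \<tau> p)) (finite_subsets_at_top (-F))"
    proof (rule Weierstrass_m_test_infsum)
      show "(\<lambda>p. 16 * norm z ^ 2 * C ^ 3 * pair_weight p) summable_on -F"
        by (intro summable_on_cmult_right summable_on_subset[OF summable_pair_weight]) auto
      show "norm (zeta_term z (lattice_pt \<tau> p)) \<le> 16 * norm z ^ 2 * C ^ 3 * pair_weight p"
        if "p \<in> -F" "\<tau> \<in> cball \<tau>0 r" for p \<tau>
        using that norm_zeta_term_lattice_pt_le[OF K(1) r K(2), of \<tau> z "fst p" "snd p"]
        by (cases p) (auto simp: F_def C_def)
    qed
    have "(\<lambda>\<tau>. \<Sum>\<^sub>\<infinity>p\<in>-F. zeta_term z (lattice_pt \<tau> p)) holomorphic_on ball \<tau>0 r"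
      proof (rule holomorphic_uniform_limit[OF _ ul])
      show "\<forall>\<^sub>F G in finite_subsets_at_top (- F).
          continuous_on (cball \<tau>0 r) (\<lambda>\<tau>. \<Sum>p\<in>G. zeta_term z (lattice_pt \<tau> p)) \<and>
          (\<lambda>\<tau>. \<Sum>p\<in>G. zeta_term z (lattice_pt \<tau> p)) holomorphic_on ball \<tau>0 r"
        using sub ball_subset_cball[of \<tau>0 r]
        by (intro always_eventually allI conjI holomorphic_on_imp_continuous_on holomorphic_on_sum
              holomorphic_on_subset[OF ht]) blast+
    qed simp
    \<comment> \<open>The finitely many terms that escape the uniform bound are holomorphic one by
      one. \<open>F\<close> depends on the disc but not on \<open>\<tau>\<close>.\<close>
    hence "(\<lambda>\<tau>. (\<Sum>p\<in>F. zeta_term z (lattice_pt \<tau> p)) + (\<Sum>\<^sub>\<infinity>p\<in>-F. zeta_term z (lattice_pt \<tau> p))) holomorphic_on ball \<tau>0 r"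
      using sub ball_subset_cball[of \<tau>0 r]
      by (intro holomorphic_on_add holomorphic_on_sum holomorphic_on_subset[OF ht]) blast
    also have "?this \<longleftrightarrow> (\<lambda>\<tau>. weierstrass_zeta (period_lattice \<tau>) z) holomorphic_on ball \<tau>0 r"
    proof (intro holomorphic_cong refl)
      fix \<tau> assume "\<tau> \<in> ball \<tau>0 r"
      hence t: "Im \<tau> > 0" using sub by (force simp: uhp_def)
      have "(\<Sum>\<^sub>\<infinity>p. zeta_term z (lattice_pt \<tau> p)) = (\<Sum>\<^sub>\<infinity>p\<in>F \<union> -F. zeta_term z (lattice_pt \<tau> p))"
        by simp
      also have "\<dots> = (\<Sum>\<^sub>\<infinity>p\<in>F. zeta_term z (lattice_pt \<tau> p)) + (\<Sum>\<^sub>\<infinity>p\<in>-F. zeta_term z (lattice_pt \<tau> p))"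
        by (intro infsum_Un_disjoint summable_zeta_term t) auto
      finally show "(\<Sum>p\<in>F. zeta_term z (lattice_pt \<tau> p)) + (\<Sum>\<^sub>\<infinity>p\<in>-F. zeta_term z (lattice_pt \<tau> p)) =
        weierstrass_zeta (period_lattice \<tau>) z"
        using fin weierstrass_zeta_eq_infsum[OF t] by simp
    qed
    finally show ?thesis
      using r by (meson centre_in_ball holomorphic_on_imp_differentiable_at open_ball)
  qed
  thus ?thesis using holomorphic_on_def field_differentiable_at_within by blast
qed

section \<open>Partial fractions of the cotangent\<close>

text \<open>Logarithmic derivative of the reflection formula for the Gamma function.\<close>

lemma Digamma_reflection:
  fixes w :: complex
  assumes "w \<notin> \<int>"
  shows "Digamma (1 - w) - Digamma w = of_real pi * cot (of_real pi * w)"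
proof -
  have w: "w \<notin> \<int>\<^sub>\<le>\<^sub>0" "1 - w \<notin> \<int>\<^sub>\<le>\<^sub>0"
    using assms by (auto dest: nonpos_Ints_Int)
  have s: "sin (of_real pi * w) \<noteq> 0"
    using assms by (auto simp: sin_eq_0)
  have F: "Gamma w * Gamma (1 - w) = of_real pi / sin (of_real pi * w)"
    by (rule Gamma_reflection_complex)
  have "((\<lambda>z. Gamma z * Gamma (1 - z)) has_field_derivative
          Gamma w * Gamma (1 - w) * (Digamma w - Digamma (1 - w))) (at w)"
    using w by (auto intro!: derivative_eq_intros simp: algebra_simps)
  moreover have "((\<lambda>z. of_real pi / sin (of_real pi * z)) has_field_derivative
          - (of_real pi / sin (of_real pi * w) * (of_real pi * cot (of_real pi * w)))) (at w)"
    using s by (auto intro!: derivative_eq_intros simp: cot_def field_simps)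
  ultimately have "Gamma w * Gamma (1 - w) * (Digamma w - Digamma (1 - w)) =
      - (of_real pi / sin (of_real pi * w) * (of_real pi * cot (of_real pi * w)))"
    unfolding Gamma_reflection_complex by (rule DERIV_unique)
  hence "Gamma w * Gamma (1 - w) * (Digamma w - Digamma (1 - w)) =
      Gamma w * Gamma (1 - w) * (- (of_real pi * cot (of_real pi * w)))"
    unfolding F by simp
  moreover have "Gamma w * Gamma (1 - w) \<noteq> 0"
    using w by (simp add: Gamma_eq_zero_iff)
  ultimately have "Digamma w - Digamma (1 - w) = - (of_real pi * cot (of_real pi * w))"
    using mult_left_cancel by blast
  thus ?thesis by (simp add: algebra_simps)
qed

lemma symmetric_int_interval_Suc:
  "{- int (Suc N)..int (Suc N)} = insert (int (Suc N)) (insert (- int (Suc N)) {- int N..int N})"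
  by auto

lemma sum_symmetric_Suc:
  "(\<Sum>m\<in>{- int (Suc N)..int (Suc N)}. f m) =
     f (int (Suc N)) + (f (- int (Suc N)) + (\<Sum>m\<in>{- int N..int N}. f m))"
  unfolding symmetric_int_interval_Suc by simp

lemma cot_partial_fractions_LIMSEQ:
  fixes w :: complex
  assumes "w \<notin> \<int>"
  shows "(\<lambda>N. \<Sum>m\<in>{-int N..int N}. 1 / (w - of_int m) + 1 / of_int m)
           \<longlonglongrightarrow> of_real pi * cot (of_real pi * w)"
proof -
  define D where "D = (\<lambda>z M. complex_of_real (ln (real M)) - (\<Sum>n<M. inverse (z + of_nat n)))"
  have D: "(\<lambda>N. D z (Suc N)) \<longlonglongrightarrow> Digamma z" if "z \<noteq> 0" for z
    unfolding D_def by (rule LIMSEQ_Suc[OF Digamma_LIMSEQ[OF that]])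
  \<comment> \<open>The logarithms cancel, and so do the \<open>1 / m\<close> in pairs.
    \<open>D w\<close> supplies the poles m = 0, ..., -N, but \<open>D (1 - w)\<close> supplies m =
    1, ..., N + 1; the last summand removes the surplus one.\<close>
  have eq: "(\<Sum>m\<in>{-int N..int N}. 1 / (w - of_int m) + 1 / of_int m) =
             D (1 - w) (Suc N) - D w (Suc N) + inverse ((1 - w) + of_nat N)" for N
  proof (induction N)
    case 0
    show ?case by (simp add: D_def divide_simps)
  next
    case (Suc N)
    have DS: "D z (Suc (Suc N)) = D z (Suc N) + (of_real (ln (Suc (Suc N))) - of_real (ln (Suc N)))
                - inverse (z + of_nat (Suc N))" for z
      unfolding D_def sum.lessThan_Suc[of _ "Suc N"] by (simp add: algebra_simps)
    have "inverse (1 - w + of_nat N) = inverse (- (w - of_nat (Suc N)))"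
      by (rule arg_cong[of _ _ inverse]) simp
    also have "\<dots> = - (1 / (w - of_nat (Suc N)))"
      by (simp only: inverse_minus_eq inverse_eq_divide minus_divide_right)
    finally show ?case
      unfolding sum_symmetric_Suc Suc DS by (simp add: inverse_eq_divide del: of_nat_Suc)
  qed
  have "(\<lambda>N. inverse ((1 - w) + of_nat N)) \<longlonglongrightarrow> 0"
    by (rule filterlim_compose[OF tendsto_inverse_0])
       (intro tendsto_add_filterlim_at_infinity[OF tendsto_const] tendsto_of_nat)
  moreover have "w \<noteq> 0" "1 - w \<noteq> 0" using assms by auto
  ultimately have "(\<lambda>N. D (1 - w) (Suc N) - D w (Suc N) + inverse ((1 - w) + of_nat N))
     \<longlonglongrightarrow> Digamma (1 - w) - Digamma w + 0"
    by (intro tendsto_intros D)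
  thus ?thesis
    unfolding eq using Digamma_reflection[OF assms] by simp
qed

text \<open>Symmetric intervals eventually contain every finite set of integers. A sum known to
  exist can therefore be evaluated along them, where telescoping and pairing are available.\<close>

lemma has_sum_int_imp_LIMSEQ:
  fixes f :: "int \<Rightarrow> 'a :: {comm_monoid_add, topological_space}"
  assumes "(f has_sum S) UNIV"
  shows "(\<lambda>N. \<Sum>m\<in>{-int N..int N}. f m) \<longlonglongrightarrow> S"
proof -
  have "filterlim (\<lambda>N. {-int N..int N}) (finite_subsets_at_top UNIV) sequentially"
    unfolding filterlim_iff eventually_finite_subsets_at_top
  proof safe
    fix P and X :: "int set"
    assume X: "finite X" "\<forall>Y. finite Y \<and> X \<subseteq> Y \<and> Y \<subseteq> UNIV \<longrightarrow> P Y"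
    have "P {-int N..int N}" if N: "N \<ge> nat (Max (insert 0 (abs ` X)))" for N
    proof -
      have "\<bar>x\<bar> \<le> int N" if "x \<in> X" for x
      proof -
        have "\<bar>x\<bar> \<le> Max (insert 0 (abs ` X))"
          using X(1) that by (intro Max_ge) auto
        thus ?thesis using N by linarith
      qed
      hence "X \<subseteq> {-int N..int N}" by force
      thus ?thesis using X(2) by simp
    qed
    thus "\<forall>\<^sub>F N in sequentially. P {-int N..int N}"
      unfolding eventually_sequentially by blast
  qed
  thus ?thesis
    using assms filterlim_compose unfolding has_sum_def by blast
qed

text \<open>The two fractions combine to \<open>w / (m * (w - m))\<close>, which decays
  quadratically in m.\<close>

lemma summable_cot_terms:
  fixes w :: complex
  shows "(\<lambda>m::int. 1 / (w - of_int m) + 1 / of_int m) summable_on UNIV"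
proof -
  define K where "K = \<lceil>max 1 (2 * norm w)\<rceil>"
  let ?f = "\<lambda>m::int. 1 / (w - of_int m) + 1 / of_int m"
  have "(\<lambda>m. norm (?f m)) summable_on - {-K..K}"
  proof (rule Infinite_Sum.abs_summable_on_comparison_test')
    show "(\<lambda>m::int. 8 * norm w * (1 + \<bar>of_int m\<bar>) powr -2) summable_on - {-K..K}"
      by (intro summable_on_cmult_right summable_on_subset[OF summable_on_int_powr]) auto
    fix m assume m: "m \<in> - {-K..K}"
    define a where "a = \<bar>real_of_int m\<bar>"
    have a: "a \<ge> 1" "a \<ge> 2 * norm w"
    proof -
      have "\<bar>m\<bar> > K" using m by auto
      hence "a > of_int K" by (simp add: a_def flip: of_int_abs)
      moreover have "of_int K \<ge> max 1 (2 * norm w)" unfolding K_def by (rule le_of_int_ceiling)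
      ultimately show "a \<ge> 1" "a \<ge> 2 * norm w" by auto
    qed
    have [simp]: "m \<noteq> 0" using a by (auto simp: a_def)
    have na: "norm (of_int m :: complex) = a" by (simp add: a_def)
    have "norm (of_int m - w) \<ge> norm (of_int m :: complex) - norm w"
      by (rule norm_triangle_ineq2)
    hence d: "norm (w - of_int m) \<ge> a / 2" using a na by (simp add: norm_minus_commute)
    hence ne: "w - of_int m \<noteq> 0" "m \<noteq> 0" using a by (auto simp: a_def)
    have "?f m = w / (of_int m * (w - of_int m))"
      using ne by (simp add: divide_simps na del: diff_eq_eq right_minus_eq)
    also have "norm \<dots> = norm w / (a * norm (w - of_int m))"
      by (simp add: norm_divide norm_mult a_def)
    also have "\<dots> \<le> norm w / (a * (a / 2))"
      using d a ne by (intro divide_left_mono mult_left_mono) auto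
    \<comment> \<open>Rescaled because \<open>2 * a\<close> dominates \<open>1 + a\<close>, as
      \<open>a \<ge> 1\<close>.\<close>
    also have "\<dots> = 8 * norm w / ((2 * a) ^ 2)"
      using a by (simp add: power2_eq_square)
    also have "\<dots> \<le> 8 * norm w / ((1 + a) ^ 2)"
      using a by (intro divide_left_mono power_mono) auto
    also have "\<dots> = 8 * norm w * (1 + a) powr -2"
      using a by (simp add: powr_minus divide_simps)
    finally show "norm (?f m) \<le> 8 * norm w * (1 + \<bar>of_int m\<bar>) powr -2"
      by (simp add: a_def)
  qed
  hence "?f summable_on (- {-K..K} \<union> {-K..K})"
    by (intro summable_on_Un_disjoint) (auto intro: abs_summable_summable)
  thus ?thesis by simp
qed

text \<open>
  The case \<^term>\<open>w = 0\<close> holds by the conventions \<^term>\<open>cot 0 = 0\<close> and \<^term>\<open>1 / 0 = 0\<close>.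
\<close>

lemma cot_partial_fractions_has_sum:
  fixes w :: complex
  assumes "w \<notin> \<int> \<or> w = 0"
  shows "((\<lambda>m::int. 1 / (w - of_int m) + 1 / of_int m) has_sum
           of_real pi * cot (of_real pi * w)) UNIV"
proof (cases "w = 0")
  case False
  hence w: "w \<notin> \<int>" using assms by auto
  let ?S = "\<Sum>\<^sub>\<infinity>m::int. 1 / (w - of_int m) + 1 / of_int m"
  have hs: "((\<lambda>m::int. 1 / (w - of_int m) + 1 / of_int m) has_sum ?S) UNIV"
    by (rule has_sum_infsum[OF summable_cot_terms])
  have "?S = of_real pi * cot (of_real pi * w)"
    by (rule LIMSEQ_unique[OF has_sum_int_imp_LIMSEQ[OF hs] cot_partial_fractions_LIMSEQ[OF w]])
  thus ?thesis using hs by simp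
qed simp

section \<open>Limit of the cotangent high in the half-plane\<close>

lemma cot_eq_exp:
  fixes w :: complex
  shows "cot w = \<i> * (exp (2 * \<i> * w) + 1) / (exp (2 * \<i> * w) - 1)"
proof -
  define E where "E = exp (\<i> * w)"
  have [simp]: "E \<noteq> 0" by (simp add: E_def)
  have "2 * \<i> * w = \<i> * w + \<i> * w" by simp
  hence e: "exp (2 * \<i> * w) = E * E" by (simp only: exp_add E_def)
  have "E + inverse E = (E * E + 1) / E" "E - inverse E = (E * E - 1) / E"
    by (simp_all add: field_simps)
  hence "cot w = ((E * E + 1) / E / 2) / ((E * E - 1) / E / (2 * \<i>))"
    unfolding cot_def sin_exp_eq cos_exp_eq exp_minus by (simp only: flip: E_def)
  \<comment> \<open>If \<open>E * E = 1\<close>, then \<open>w\<close> is a pole and division by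
    zero makes both sides 0.\<close>
  also have "\<dots> = \<i> * (E * E + 1) / (E * E - 1)"
    by (cases "E * E = 1") (simp_all add: divide_simps)
  finally show ?thesis unfolding e .
qed

text \<open>With q = \<open>exp (2 * \<i> * w)\<close> the cotangent is
  \<open>\<i> * (q + 1) / (q - 1)\<close>, and the norm of q is \<open>exp (- 2 * Im w)\<close>,
  which tends to 0.\<close>

lemma tendsto_cot_Im_at_top:
  fixes w :: "'a \<Rightarrow> complex"
  assumes "filterlim (\<lambda>x. Im (w x)) at_top F"
  shows "((\<lambda>x. cot (w x)) \<longlongrightarrow> -\<i>) F"
proof -
  have "filterlim (\<lambda>x. Im (w x) * 2) at_top F"
    by (intro filterlim_at_top_mult_tendsto_pos[OF tendsto_const _ assms]) auto
  hence "filterlim (\<lambda>x. - (Im (w x) * 2)) at_bot F"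
    by (simp add: filterlim_uminus_at_top)
  hence "((\<lambda>x. exp (- (Im (w x) * 2))) \<longlongrightarrow> 0) F"
    by (rule filterlim_compose[OF exp_at_bot])
  hence "((\<lambda>x. norm (exp (2 * \<i> * w x))) \<longlongrightarrow> 0) F"
    by (simp add: mult.commute)
  hence q: "((\<lambda>x. exp (2 * \<i> * w x)) \<longlongrightarrow> 0) F"
    by (rule tendsto_norm_zero_cancel)
  have "((\<lambda>x. \<i> * (exp (2 * \<i> * w x) + 1) / (exp (2 * \<i> * w x) - 1)) \<longlongrightarrow> \<i> * (0 + 1) / (0 - 1)) F"
    by (intro tendsto_intros q) auto
  thus ?thesis by (simp add: cot_eq_exp)
qed

section \<open>Quasi-periods and the Legendre relation\<close>

lemma has_sum_diff:
  fixes f g :: "'a \<Rightarrow> 'b :: topological_ab_group_add"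
  assumes "(f has_sum a) A" "(g has_sum b) A"
  shows "((\<lambda>x. f x - g x) has_sum (a - b)) A"
  using has_sum_add[OF assms(1), of "\<lambda>x. - g x" "- b"] assms(2) by (simp add: has_sum_uminus)

lemma summable_on_diff:
  fixes f g :: "'a \<Rightarrow> 'b :: topological_ab_group_add"
  assumes "f summable_on A" "g summable_on A"
  shows "(\<lambda>x. f x - g x) summable_on A"
  using assms has_sum_diff unfolding summable_on_def by blast

section \<open>Row decomposition of the zeta series\<close>

definition row_sum :: "complex \<Rightarrow> int \<Rightarrow> complex" where
  "row_sum \<tau> n = (\<Sum>\<^sub>\<infinity>m. 1 / lattice_pt \<tau> (n, m) ^ 2)"

text \<open>The Eisenstein series of weight 2 in Eisenstein's order of summation. The origin
  contributes \<open>1 / 0 = 0\<close> to the row n = 0.\<close>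

definition eisenstein2 :: "complex \<Rightarrow> complex" where
  "eisenstein2 \<tau> = (\<Sum>\<^sub>\<infinity>n. row_sum \<tau> n)"

definition pi_cot :: "complex \<Rightarrow> complex" where
  "pi_cot z = of_real pi * cot (of_real pi * z)"

lemma pi_cot_minus: "pi_cot (-z) = - pi_cot z"
  by (simp add: pi_cot_def)

lemma pi_cot_plus_1: "pi_cot (z + 1) = pi_cot z"
proof -
  have "of_real pi * (z + 1) = of_real pi * z + of_real pi" by (simp add: algebra_simps)
  thus ?thesis by (simp add: pi_cot_def cot_def sin_add cos_add)
qed

text \<open>The inserted \<open>1 / m\<close> cancel; they make each of the three pieces summable
  over m by itself.\<close>

lemma zeta_term_lattice_pt_eq:
  "zeta_term z (lattice_pt \<tau> (n, m)) =
     (1 / ((z - of_int n * \<tau>) - of_int m) + 1 / of_int m)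
     - (1 / (- (of_int n * \<tau>) - of_int m) + 1 / of_int m)
     + z * (1 / lattice_pt \<tau> (n, m) ^ 2)"
proof -
  have "- (of_int n * \<tau>) - of_int m = - lattice_pt \<tau> (n, m)"
    "(z - of_int n * \<tau>) - of_int m = z - lattice_pt \<tau> (n, m)"
    by (simp_all add: lattice_pt_def)
  thus ?thesis unfolding zeta_term_def by simp
qed

lemma summable_row:
  assumes "Im \<tau> > 0"
  shows "(\<lambda>m. zeta_term z (lattice_pt \<tau> (n, m))) summable_on UNIV"
proof -
  have "(\<lambda>(n, m). zeta_term z (lattice_pt \<tau> (n, m))) summable_on Sigma UNIV (\<lambda>_. UNIV)"
    using summable_zeta_term[OF assms] by (simp add: case_prod_unfold)
  thus ?thesis by (rule summable_on_SigmaD1) auto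
qed

text \<open>At z = 1 the decomposition can be solved for the inverse squares, which inherit
  summability from the zeta and cotangent terms.\<close>

lemma summable_row_inverse_squares:
  assumes "Im \<tau> > 0"
  shows "(\<lambda>m. 1 / lattice_pt \<tau> (n, m) ^ 2) summable_on UNIV"
proof -
  have "(\<lambda>m. zeta_term 1 (lattice_pt \<tau> (n, m))
           - (1 / ((1 - of_int n * \<tau>) - of_int m) + 1 / of_int m)
           + (1 / (- (of_int n * \<tau>) - of_int m) + 1 / of_int m)) summable_on UNIV"
    by (intro summable_on_add summable_on_diff summable_row assms summable_cot_terms)
  also have "(\<lambda>m. zeta_term 1 (lattice_pt \<tau> (n, m))
           - (1 / ((1 - of_int n * \<tau>) - of_int m) + 1 / of_int m)
           + (1 / (- (of_int n * \<tau>) - of_int m) + 1 / of_int m))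
           = (\<lambda>m. 1 / lattice_pt \<tau> (n, m) ^ 2)"
    unfolding zeta_term_lattice_pt_eq by simp
  finally show ?thesis .
qed

lemma minus_of_int_mult_notin_Ints:
  assumes "z \<notin> period_lattice \<tau>"
  shows "z - of_int n * \<tau> \<notin> \<int>"
proof
  assume "z - of_int n * \<tau> \<in> \<int>"
  then obtain m where "z - of_int n * \<tau> = of_int m" by (auto elim: Ints_cases)
  hence "z = of_int m + of_int n * \<tau>" by (simp add: algebra_simps)
  thus False using assms by (auto simp: period_lattice_def)
qed

text \<open>The row n = 0 falls under the degenerate case of the cotangent expansion.\<close>

lemma of_int_mult_notin_Ints:
  assumes "Im \<tau> > 0"
  shows "- (of_int n * \<tau>) \<notin> \<int> \<or> - (of_int n * \<tau>) = 0"
  using assms by (cases "n = 0") (auto simp: complex_is_Int_iff)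

lemma zeta_row_has_sum:
  assumes "Im \<tau> > 0" "z \<notin> period_lattice \<tau>"
  shows "((\<lambda>m. zeta_term z (lattice_pt \<tau> (n, m))) has_sum
           (pi_cot (z - of_int n * \<tau>) - pi_cot (- (of_int n * \<tau>)) + z * row_sum \<tau> n)) UNIV"
  unfolding zeta_term_lattice_pt_eq pi_cot_def row_sum_def
  using minus_of_int_mult_notin_Ints[OF assms(2)] of_int_mult_notin_Ints[OF assms(1)]
  by (intro has_sum_add has_sum_diff has_sum_cmult_right has_sum_infsum cot_partial_fractions_has_sum
            summable_row_inverse_squares assms) auto

lemma weierstrass_zeta_has_sum_rows:
  assumes "Im \<tau> > 0" "z \<notin> period_lattice \<tau>"
  shows "((\<lambda>n. pi_cot (z - of_int n * \<tau>) - pi_cot (- (of_int n * \<tau>)) + z * row_sum \<tau> n) has_sum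
           weierstrass_zeta (period_lattice \<tau>) z) UNIV"
proof (rule has_sum_SigmaD)
  show "((\<lambda>p. zeta_term z (lattice_pt \<tau> p)) has_sum weierstrass_zeta (period_lattice \<tau>) z)
          (Sigma UNIV (\<lambda>_. UNIV))"
    using has_sum_infsum[OF summable_zeta_term[OF assms(1)]]
    by (simp add: weierstrass_zeta_eq_infsum[OF assms(1)])
qed (use zeta_row_has_sum[OF assms] in auto)

section \<open>The period lattice as a group\<close>

lemma period_lattice_memI: "of_int m + of_int n * \<tau> \<in> period_lattice \<tau>"
  by (auto simp: period_lattice_def)

lemma period_lattice_add:
  "x \<in> period_lattice \<tau> \<Longrightarrow> y \<in> period_lattice \<tau> \<Longrightarrow> x + y \<in> period_lattice \<tau>"
proof -
  assume "x \<in> period_lattice \<tau>" "y \<in> period_lattice \<tau>"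
  then obtain m n m' n' where "x = of_int m + of_int n * \<tau>" "y = of_int m' + of_int n' * \<tau>"
    by (auto simp: period_lattice_def)
  hence "x + y = of_int (m + m') + of_int (n + n') * \<tau>" by (simp add: algebra_simps)
  thus ?thesis by (metis period_lattice_memI)
qed

lemma period_lattice_minus: "x \<in> period_lattice \<tau> \<Longrightarrow> -x \<in> period_lattice \<tau>"
proof -
  assume "x \<in> period_lattice \<tau>"
  then obtain m n where "x = of_int m + of_int n * \<tau>"
    by (auto simp: period_lattice_def)
  hence "-x = of_int (-m) + of_int (-n) * \<tau>" by (simp add: algebra_simps)
  thus ?thesis by (metis period_lattice_memI)
qed

lemma period_lattice_add_iff:
  assumes "y \<in> period_lattice \<tau>"
  shows "x + y \<in> period_lattice \<tau> \<longleftrightarrow> x \<in> period_lattice \<tau>"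
  using period_lattice_add[OF _ assms] period_lattice_add[OF _ period_lattice_minus[OF assms], of "x + y"]
  by auto

lemma one_in_period_lattice: "1 \<in> period_lattice \<tau>"
  using period_lattice_memI[of 1 0 \<tau>] by simp

lemma tau_in_period_lattice: "\<tau> \<in> period_lattice \<tau>"
  using period_lattice_memI[of 0 1 \<tau>] by simp

lemma real_notin_period_lattice:
  assumes "Im \<tau> > 0" "x \<notin> \<int>"
  shows "complex_of_real x \<notin> period_lattice \<tau>"
  using assms by (auto simp: period_lattice_def complex_eq_iff)

lemma half_notin_Ints: "(1/2 :: real) \<notin> \<int>" "(-1/2 :: real) \<notin> \<int>"
proof -
  show *: "(1/2 :: real) \<notin> \<int>"
  proof
    assume "(1/2 :: real) \<in> \<int>"
    then obtain k where "1/2 = real_of_int k" by (auto elim: Ints_cases)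
    hence "of_int (2 * k) = (1::real)" by simp
    hence "2 * k = 1" by linarith
    thus False by presburger
  qed
  show "(-1/2 :: real) \<notin> \<int>"
    using * by (metis Ints_minus minus_divide_left minus_minus)
qed

lemma half_notin_period_lattice:
  assumes "Im \<tau> > 0"
  shows "1/2 \<notin> period_lattice \<tau>" "-1/2 \<notin> period_lattice \<tau>"
  using real_notin_period_lattice[OF assms half_notin_Ints(1)]
    real_notin_period_lattice[OF assms half_notin_Ints(2)] by simp_all

text \<open>The condition under the description operator of \<open>quasi_period\<close>, made a
  relation so that it can be added, negated and scaled before existence and uniqueness are
  combined.\<close>

definition is_quasi_period :: "complex set \<Rightarrow> complex \<Rightarrow> complex \<Rightarrow> bool" where
  "is_quasi_period \<Lambda> \<omega> e \<longleftrightarrow>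
     (\<forall>z. z \<notin> \<Lambda> \<longrightarrow> weierstrass_zeta \<Lambda> (z + \<omega>) = weierstrass_zeta \<Lambda> z + e)"

text \<open>One point off the lattice determines \<open>e\<close> as a difference of two zeta
  values.\<close>

lemma quasi_period_eqI:
  assumes "is_quasi_period \<Lambda> \<omega> e" "z \<notin> \<Lambda>"
  shows "quasi_period \<Lambda> \<omega> = e"
  unfolding quasi_period_def
proof (rule the_equality)
  show "\<forall>z. z \<notin> \<Lambda> \<longrightarrow> weierstrass_zeta \<Lambda> (z + \<omega>) = weierstrass_zeta \<Lambda> z + e"
    using assms(1) by (simp add: is_quasi_period_def)
  fix e' assume "\<forall>z. z \<notin> \<Lambda> \<longrightarrow> weierstrass_zeta \<Lambda> (z + \<omega>) = weierstrass_zeta \<Lambda> z + e'"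
  with assms show "e' = e" unfolding is_quasi_period_def by (metis add_left_cancel)
qed

text \<open>The cotangent parts at \<open>z + 1\<close> and \<open>z\<close> cancel, and the
  coefficient of \<open>row_sum\<close> becomes 1. Summability of the row sums is part of the
  conclusion.\<close>

lemma row_sum_has_sum:
  assumes "Im \<tau> > 0" "z \<notin> period_lattice \<tau>"
  shows "(row_sum \<tau> has_sum (weierstrass_zeta (period_lattice \<tau>) (z + 1) -
            weierstrass_zeta (period_lattice \<tau>) z)) UNIV"
proof -
  have z1: "z + 1 \<notin> period_lattice \<tau>"
    using assms(2) by (simp add: period_lattice_add_iff one_in_period_lattice)
  have p: "pi_cot (z + 1 - of_int n * \<tau>) = pi_cot (z - of_int n * \<tau>)" for n
    using pi_cot_plus_1[of "z - of_int n * \<tau>"] by (simp add: algebra_simps)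
  show ?thesis
    using has_sum_diff[OF weierstrass_zeta_has_sum_rows[OF assms(1) z1] weierstrass_zeta_has_sum_rows[OF assms]]
    unfolding p by (simp add: algebra_simps)
qed

lemma is_quasi_period_one:
  assumes "Im \<tau> > 0"
  shows "is_quasi_period (period_lattice \<tau>) 1 (eisenstein2 \<tau>)"
  unfolding is_quasi_period_def eisenstein2_def
proof safe
  fix z assume "z \<notin> period_lattice \<tau>"
  from infsumI[OF row_sum_has_sum[OF assms this]]
  show "weierstrass_zeta (period_lattice \<tau>) (z + 1) = weierstrass_zeta (period_lattice \<tau>) z + infsum (row_sum \<tau>) UNIV"
    by simp
qed

lemma row_sum_has_sum_eisenstein2:
  assumes "Im \<tau> > 0"
  shows "(row_sum \<tau> has_sum eisenstein2 \<tau>) UNIV"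
  unfolding eisenstein2_def
  using row_sum_has_sum[OF assms half_notin_period_lattice(1)[OF assms]]
  by (metis has_sum_infsum summable_on_def)

lemma is_quasi_period_tau:
  assumes t: "Im \<tau> > 0"
  shows "is_quasi_period (period_lattice \<tau>) \<tau> (\<tau> * eisenstein2 \<tau> - 2 * of_real pi * \<i>)"
  unfolding is_quasi_period_def
proof safe
  fix z assume z: "z \<notin> period_lattice \<tau>"
  have z1: "z + \<tau> \<notin> period_lattice \<tau>"
    using z by (simp add: period_lattice_add_iff tau_in_period_lattice)
  define D where "D = weierstrass_zeta (period_lattice \<tau>) (z + \<tau>) - weierstrass_zeta (period_lattice \<tau>) z"
  define d where "d = (\<lambda>n. pi_cot (z + \<tau> - of_int n * \<tau>) - pi_cot (z - of_int n * \<tau>))"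
  have "(d has_sum (D - \<tau> * eisenstein2 \<tau>)) UNIV"
    using has_sum_diff[OF has_sum_diff[OF weierstrass_zeta_has_sum_rows[OF t z1] weierstrass_zeta_has_sum_rows[OF t z]]
      has_sum_cmult_right[OF row_sum_has_sum_eisenstein2[OF t], of \<tau>]]
    unfolding d_def D_def by (simp add: algebra_simps)
  \<comment> \<open>Convergence is already known, so the value may be computed along symmetric
    intervals.\<close>
  hence lim: "(\<lambda>N. \<Sum>n\<in>{-int N..int N}. d n) \<longlonglongrightarrow> D - \<tau> * eisenstein2 \<tau>"
    by (rule has_sum_int_imp_LIMSEQ)
  \<comment> \<open>Adding \<open>\<tau>\<close> lowers n by one, so the upper end of the telescope
    is n = -N - 1 and carries \<open>Suc N\<close>, while the lower end carries N.\<close>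
  have tele: "(\<Sum>n\<in>{-int N..int N}. d n) =
      pi_cot (z + of_nat (Suc N) * \<tau>) - pi_cot (z - of_nat N * \<tau>)" for N
  proof (induction N)
    case 0
    show ?case by (simp add: d_def)
  next
    case (Suc N)
    show ?case unfolding sum_symmetric_Suc Suc by (simp add: d_def algebra_simps)
  qed
  have up: "(\<lambda>N. pi_cot (z + of_nat (Suc N) * \<tau>)) \<longlonglongrightarrow> of_real pi * (-\<i>)"
    unfolding pi_cot_def
  proof (intro tendsto_mult tendsto_const tendsto_cot_Im_at_top)
    show "filterlim (\<lambda>N. Im (of_real pi * (z + of_nat (Suc N) * \<tau>))) at_top sequentially"
    proof -
      have "filterlim (\<lambda>N. pi * Im z + real (Suc N) * (pi * Im \<tau>)) at_top sequentially"
        using t by (intro filterlim_tendsto_add_at_top[OF tendsto_const]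
            filterlim_at_top_mult_tendsto_pos[OF tendsto_const]
            filterlim_compose[OF filterlim_real_sequentially filterlim_Suc]) auto
      thus ?thesis by (simp add: algebra_simps)
    qed
  qed
  \<comment> \<open>The lower end moves downwards; since the cotangent is odd, it is reflected to
    the upward limit.\<close>
  have down: "(\<lambda>N. pi_cot (- z + of_nat N * \<tau>)) \<longlonglongrightarrow> of_real pi * (-\<i>)"
    unfolding pi_cot_def
  proof (intro tendsto_mult tendsto_const tendsto_cot_Im_at_top)
    show "filterlim (\<lambda>N. Im (of_real pi * (-z + of_nat N * \<tau>))) at_top sequentially"
    proof -
      have "filterlim (\<lambda>N. - (pi * Im z) + real N * (pi * Im \<tau>)) at_top sequentially"
        using t by (intro filterlim_tendsto_add_at_top[OF tendsto_const]
            filterlim_at_top_mult_tendsto_pos[OF tendsto_const] filterlim_real_sequentially) auto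
      thus ?thesis by (simp add: algebra_simps)
    qed
  qed
  have "pi_cot (z - of_nat N * \<tau>) = - pi_cot (- z + of_nat N * \<tau>)" for N
    using pi_cot_minus[of "z - of_nat N * \<tau>"] by simp
  hence "(\<lambda>N. \<Sum>n\<in>{-int N..int N}. d n) \<longlonglongrightarrow> of_real pi * (-\<i>) + of_real pi * (-\<i>)"
    unfolding tele using tendsto_add[OF up down] by simp
  with lim have "D - \<tau> * eisenstein2 \<tau> = of_real pi * (-\<i>) + of_real pi * (-\<i>)"
    using LIMSEQ_unique by blast
  thus "weierstrass_zeta (period_lattice \<tau>) (z + \<tau>) =
      weierstrass_zeta (period_lattice \<tau>) z + (\<tau> * eisenstein2 \<tau> - 2 * of_real pi * \<i>)"
    by (simp add: D_def algebra_simps)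
qed

section \<open>Linearity and homogeneity of quasi-periods\<close>

lemma is_quasi_period_add:
  assumes "is_quasi_period (period_lattice \<tau>) \<omega> e" "is_quasi_period (period_lattice \<tau>) \<omega>' e'"
    "\<omega> \<in> period_lattice \<tau>"
  shows "is_quasi_period (period_lattice \<tau>) (\<omega> + \<omega>') (e + e')"
  using assms unfolding is_quasi_period_def
  by (metis (no_types, lifting) period_lattice_add_iff add.assoc)

lemma is_quasi_period_minus:
  assumes "is_quasi_period (period_lattice \<tau>) \<omega> e" "\<omega> \<in> period_lattice \<tau>"
  shows "is_quasi_period (period_lattice \<tau>) (-\<omega>) (-e)"
  unfolding is_quasi_period_def
proof safe
  fix z assume "z \<notin> period_lattice \<tau>"
  hence "z + -\<omega> \<notin> period_lattice \<tau>"
    using period_lattice_add_iff[OF period_lattice_minus[OF assms(2)]] by simp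
  with assms(1) have "weierstrass_zeta (period_lattice \<tau>) ((z + -\<omega>) + \<omega>) =
      weierstrass_zeta (period_lattice \<tau>) (z + -\<omega>) + e"
    unfolding is_quasi_period_def by blast
  thus "weierstrass_zeta (period_lattice \<tau>) (z + -\<omega>) = weierstrass_zeta (period_lattice \<tau>) z + -e"
    by simp
qed

lemma is_quasi_period_of_int_mult:
  assumes "is_quasi_period (period_lattice \<tau>) \<omega> e" "\<omega> \<in> period_lattice \<tau>"
  shows "is_quasi_period (period_lattice \<tau>) (of_int k * \<omega>) (of_int k * e)"
proof (induction k rule: int_induct[where k = 0])
  case base
  show ?case by (simp add: is_quasi_period_def)
next
  case (step1 i)
  from is_quasi_period_add[OF assms(1) step1(2) assms(2)] show ?case
    by (simp add: algebra_simps)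
next
  case (step2 i)
  from is_quasi_period_add[OF is_quasi_period_minus[OF assms] step2(2) period_lattice_minus[OF assms(2)]]
  show ?case by (simp add: algebra_simps)
qed

lemma of_int_mult_in_period_lattice:
  assumes "\<omega> \<in> period_lattice \<tau>"
  shows "of_int k * \<omega> \<in> period_lattice \<tau>"
proof -
  obtain m n where "\<omega> = of_int m + of_int n * \<tau>"
    using assms by (auto simp: period_lattice_def)
  hence "of_int k * \<omega> = of_int (k * m) + of_int (k * n) * \<tau>" by (simp add: algebra_simps)
  thus ?thesis by (metis period_lattice_memI)
qed

text \<open>Needed at \<open>a * \<tau> + b\<close> and \<open>c * \<tau> + d\<close>, which
  division by the automorphy factor turns into the moved point and 1.\<close>

lemma quasi_period_linear:
  assumes "Im \<tau> > 0"
  shows "is_quasi_period (period_lattice \<tau>) (of_int a * \<tau> + of_int b)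
           (of_int a * quasi_period (period_lattice \<tau>) \<tau> + of_int b * quasi_period (period_lattice \<tau>) 1)"
proof -
  have e: "quasi_period (period_lattice \<tau>) \<tau> = \<tau> * eisenstein2 \<tau> - 2 * of_real pi * \<i>"
    "quasi_period (period_lattice \<tau>) 1 = eisenstein2 \<tau>"
    using quasi_period_eqI is_quasi_period_one[OF assms] is_quasi_period_tau[OF assms]
      half_notin_period_lattice[OF assms] by blast+
  show ?thesis unfolding e
    using is_quasi_period_add[OF
        is_quasi_period_of_int_mult[OF is_quasi_period_tau[OF assms] tau_in_period_lattice, of a]
        is_quasi_period_of_int_mult[OF is_quasi_period_one[OF assms] one_in_period_lattice, of b]
        of_int_mult_in_period_lattice[OF tau_in_period_lattice]]
    by simp
qed

lemma legendre_relation: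
  assumes "Im \<tau> > 0"
  shows "quasi_period (period_lattice \<tau>) \<tau> =
           \<tau> * quasi_period (period_lattice \<tau>) 1 - 2 * of_real pi * \<i>"
  using quasi_period_eqI is_quasi_period_one[OF assms] is_quasi_period_tau[OF assms]
      half_notin_period_lattice[OF assms] by metis

text \<open>Every summand is homogeneous of degree -1, and multiplication by \<open>c\<close>
  reindexes the lattice.\<close>

lemma weierstrass_zeta_scale:
  assumes "c \<noteq> 0"
  shows "weierstrass_zeta ((*) c ` \<Lambda>) (c * z) = weierstrass_zeta \<Lambda> z / c"
proof -
  have eq: "(*) c ` \<Lambda> - {0} = (*) c ` (\<Lambda> - {0})"
    using assms by auto
  have "1 / (c * z - c * \<omega>) + 1 / (c * \<omega>) + c * z / (c * \<omega>)\<^sup>2 =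
      (1 / c) * (1 / (z - \<omega>) + 1 / \<omega> + z / \<omega>\<^sup>2)" for \<omega>
  proof -
    have "c * z - c * \<omega> = c * (z - \<omega>)" by (simp add: algebra_simps)
    thus ?thesis using assms by (simp add: distrib_left power2_eq_square)
  qed
  hence "weierstrass_zeta ((*) c ` \<Lambda>) (c * z) = 1 / (c * z) +
     (\<Sum>\<^sub>\<infinity>\<omega>\<in>\<Lambda> - {0}. (1 / c) * (1 / (z - \<omega>) + 1 / \<omega> + z / \<omega>\<^sup>2))"
    unfolding weierstrass_zeta_def eq
    by (subst infsum_reindex) (use assms in \<open>auto simp: inj_on_def o_def\<close>)
  thus ?thesis
    by (simp only: infsum_cmult_right') (simp add: weierstrass_zeta_def add_divide_distrib)
qed

lemma is_quasi_period_scale: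
  assumes "is_quasi_period \<Lambda> \<omega> e" "c \<noteq> 0"
  shows "is_quasi_period ((*) c ` \<Lambda>) (c * \<omega>) (e / c)"
  unfolding is_quasi_period_def
proof safe
  fix z assume z: "z \<notin> (*) c ` \<Lambda>"
  define w where "w = z / c"
  have zw: "z = c * w" using assms by (simp add: w_def)
  have "w \<notin> \<Lambda>" using z zw by auto
  hence "weierstrass_zeta \<Lambda> (w + \<omega>) = weierstrass_zeta \<Lambda> w + e"
    using assms(1) by (simp add: is_quasi_period_def)
  thus "weierstrass_zeta ((*) c ` \<Lambda>) (z + c * \<omega>) = weierstrass_zeta ((*) c ` \<Lambda>) z + e / c"
    unfolding zw using assms(2)
    by (simp only: weierstrass_zeta_scale[OF assms(2)] add_divide_distrib flip: distrib_left)
qed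

section \<open>Holomorphic dependence of the quasi-periods on the lattice\<close>

lemma holomorphic_quasi_period_one:
  "(\<lambda>\<tau>. quasi_period (period_lattice \<tau>) 1) holomorphic_on uhp"
proof -
  have "(\<lambda>\<tau>. weierstrass_zeta (period_lattice \<tau>) (1/2) - weierstrass_zeta (period_lattice \<tau>) (-1/2))
           holomorphic_on uhp"
    using half_notin_period_lattice
    by (intro holomorphic_intros holomorphic_zeta_in_tau) (auto simp: uhp_def)
  also have "?this \<longleftrightarrow> ?thesis"
  proof (intro holomorphic_cong refl)
    fix \<tau> assume "\<tau> \<in> uhp"
    hence t: "Im \<tau> > 0" by (simp add: uhp_def)
    have q: "quasi_period (period_lattice \<tau>) 1 = eisenstein2 \<tau>"
      using quasi_period_eqI is_quasi_period_one[OF t] half_notin_period_lattice[OF t] by blast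
    have "weierstrass_zeta (period_lattice \<tau>) (-1/2 + 1) = weierstrass_zeta (period_lattice \<tau>) (-1/2) + eisenstein2 \<tau>"
      using is_quasi_period_one[OF t] half_notin_period_lattice(2)[OF t] unfolding is_quasi_period_def by blast
    thus "weierstrass_zeta (period_lattice \<tau>) (1/2) - weierstrass_zeta (period_lattice \<tau>) (-1/2) =
        quasi_period (period_lattice \<tau>) 1"
      unfolding q by simp
  qed
  finally show ?thesis .
qed

text \<open>Transferred from eta(1) by the Legendre relation. A difference of zeta values for
  eta(tau) would have an argument that moves with \<open>\<tau>\<close>.\<close>

lemma holomorphic_quasi_period_tau:
  "(\<lambda>\<tau>. quasi_period (period_lattice \<tau>) \<tau>) holomorphic_on uhp"
proof -
  have "(\<lambda>\<tau>. \<tau> * quasi_period (period_lattice \<tau>) 1 - 2 * of_real pi * \<i>) holomorphic_on uhp"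
    by (intro holomorphic_intros holomorphic_quasi_period_one)
  also have "?this \<longleftrightarrow> ?thesis"
    by (intro holomorphic_cong refl) (simp add: legendre_relation uhp_def)
  finally show ?thesis .
qed

section \<open>The action on the Riemann sphere\<close>

lemma matrix_mult_2_nth:
  fixes A B :: "'a::semiring_1^2^2"
  shows "(A ** B) $ i $ j = A$i$1 * B$1$j + A$i$2 * B$2$j"
  by (simp add: matrix_matrix_mult_def sum_2)

text \<open>In homogeneous coordinates this is associativity of the matrix product. A nonzero
  determinant of \<open>B\<close> keeps the intermediate pair \<open>(u, v)\<close> away from (0,
  0).\<close>

lemma sphere_act_mult:
  assumes "det B \<noteq> 0"
  shows "sphere_act (A ** B) w = sphere_act A (sphere_act B w)"
proof -
  obtain a b c d where B: "B$1$1 = a" "B$1$2 = b" "B$2$1 = c" "B$2$2 = d" by blast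
  obtain a' b' c' d' where A: "A$1$1 = a'" "A$1$2 = b'" "A$2$1 = c'" "A$2$2 = d'" by blast
  have det: "a * d - b * c \<noteq> 0" using assms by (simp add: det_2 B)
  show ?thesis
  proof (cases w)
    case None
    show ?thesis
    proof (cases "c = 0")
      case True
      thus ?thesis using det None by (simp add: sphere_act_def matrix_mult_2_nth A B)
    next
      case False
      have "c' * (a / c) + d' = (c' * a + d' * c) / c" using False by (simp add: field_simps)
      thus ?thesis using False None
        by (simp add: sphere_act_def matrix_mult_2_nth A B moebius_def divide_simps)
    qed
  next
    case (Some z)
    define u where "u = a * z + b"
    define v where "v = c * z + d"
    have uv: "(a' * a + b' * c) * z + (a' * b + b' * d) = a' * u + b' * v"
       "(c' * a + d' * c) * z + (c' * b + d' * d) = c' * u + d' * v"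
      by (simp_all add: u_def v_def algebra_simps)
    show ?thesis
    proof (cases "v = 0")
      case True
      \<comment> \<open>Cramer's rule: if \<open>u\<close> vanished along with \<open>v\<close>, so
        would the determinant.\<close>
      have "d * u - b * v = (a * d - b * c) * z" "a * v - c * u = a * d - b * c"
        by (simp_all add: u_def v_def algebra_simps)
      hence "u \<noteq> 0" using True det by auto
      thus ?thesis using True Some
        by (simp add: sphere_act_def matrix_mult_2_nth A B moebius_def uv flip: u_def v_def)
    next
      case False
      have "c' * (u / v) + d' = (c' * u + d' * v) / v" "a' * (u / v) + b' = (a' * u + b' * v) / v"
        using False by (simp_all add: field_simps)
      thus ?thesis using False Some
        by (simp add: sphere_act_def matrix_mult_2_nth A B moebius_def uv flip: u_def v_def)
    qed
  qed
qed

lemma sphere_act_mat_1: "sphere_act (mat 1) w = w"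
  by (cases w) (simp_all add: sphere_act_def mat_def moebius_def)

lemma sphere_act_matrix_inv_cancel:
  assumes "det A \<noteq> 0"
  shows "sphere_act (matrix_inv A) (sphere_act A w) = w" "sphere_act A (sphere_act (matrix_inv A) w) = w"
proof -
  have inv: "invertible A" using assms by (simp add: invertible_det_nz)
  have "A ** matrix_inv A = mat 1 \<and> matrix_inv A ** A = mat 1"
    using someI_ex[OF inv[unfolded invertible_def]] by (simp only: matrix_inv_def)
  hence mi: "A ** matrix_inv A = mat 1" "matrix_inv A ** A = mat 1" by blast+
  hence "det A * det (matrix_inv A) = 1" by (metis det_I det_mul)
  hence "det (matrix_inv A) \<noteq> 0" by auto
  thus "sphere_act (matrix_inv A) (sphere_act A w) = w" "sphere_act A (sphere_act (matrix_inv A) w) = w"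
    using assms by (simp_all add: mi sphere_act_mat_1 flip: sphere_act_mult)
qed

text \<open>Its entries are visibly holomorphic when those of \<open>A\<close> are, unlike the
  entries of \<open>matrix_inv\<close>, which is defined by choice.\<close>

definition adjugate2 :: "'a::comm_ring_1^2^2 \<Rightarrow> 'a^2^2" where
  "adjugate2 A = vector [vector [A$2$2, - A$1$2], vector [- A$2$1, A$1$1]]"

lemma det_adjugate2: "det (adjugate2 A) = det A"
  by (simp add: adjugate2_def det_2)

text \<open>The adjugate is the inverse times the determinant, and nonzero scalars act trivially on
  the sphere.\<close>

lemma sphere_act_matrix_inv:
  assumes "det A \<noteq> 0"
  shows "sphere_act (matrix_inv A) w = sphere_act (adjugate2 A) w"
proof -
  have "A$1$1 * A$2$2 - A$1$2 * A$2$1 \<noteq> 0" using assms by (simp add: det_2)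
  hence "sphere_act (A ** adjugate2 A) w = w"
    by (cases w) (auto simp: sphere_act_def matrix_mult_2_nth adjugate2_def moebius_def divide_simps algebra_simps)
  hence "sphere_act A (sphere_act (adjugate2 A) w) = w"
    using assms by (simp add: sphere_act_mult det_adjugate2)
  thus ?thesis using sphere_act_matrix_inv_cancel(1)[OF assms] by metis
qed

section \<open>Moebius transforms of meromorphic functions\<close>

lemma connected_uhp: "connected uhp"
  unfolding uhp_def by (intro convex_connected convex_halfspace_Im_gt)

text \<open>\<open>remove_sings\<close> depends only on limits, so the sphere value can be certified
  from the behaviour of \<open>q\<close> near \<open>p\<close>, whatever a division by zero makes of
  \<open>q p\<close>.\<close>

lemma sphere_fun_eqI:
  assumes "p \<in> uhp" "isolated_singularity_at q p"
    and "\<And>L. w = Some L \<Longrightarrow> q \<midarrow>p\<rightarrow> L"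
    and "w = None \<Longrightarrow> is_pole q p"
  shows "sphere_fun (remove_sings q) p = w"
proof (cases w)
  case None
  thus ?thesis using assms by (simp add: sphere_fun_def)
next
  case (Some L)
  with assms have q: "q \<midarrow>p\<rightarrow> L" by blast
  hence "remove_sings q p = L" by (rule remove_sings_eqI)
  moreover have "\<not> is_pole q p"
    using q unfolding is_pole_def by (metis not_tendsto_and_filterlim_at_infinity trivial_limit_at)
  ultimately show ?thesis using assms Some by (simp add: sphere_fun_def)
qed

text \<open>The condition \<open>nz\<close> says that the image of the value of \<open>g\<close> at
  \<open>p\<close> is finite. At a pole the denominator is divided by \<open>g\<close> and then
  tends to \<open>c p\<close>.\<close>

lemma eventually_moebius_denom_nz:
  fixes g c d :: "complex \<Rightarrow> complex"
  assumes g: "g nicely_meromorphic_on A" "p \<in> A"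
    and cd: "isCont c p" "isCont d p"
    and nz: "if is_pole g p then c p \<noteq> 0 else c p * g p + d p \<noteq> 0"
  shows "eventually (\<lambda>z. c z * g z + d z \<noteq> 0) (at p)"
proof (cases "is_pole g p")
  case False
  have "isCont g p"
    using nicely_meromorphic_on_imp_analytic_at[OF g False] analytic_at_imp_isCont by blast
  hence "isCont (\<lambda>z. c z * g z + d z) p" using cd by (intro continuous_intros)
  hence "((\<lambda>z. c z * g z + d z) \<longlongrightarrow> c p * g p + d p) (at p)" by (simp add: isCont_def)
  thus ?thesis using False nz by (intro tendsto_imp_eventually_ne) auto
next
  case True
  hence gi: "filterlim g at_infinity (at p)" by (simp add: is_pole_def)
  hence i0: "((\<lambda>z. inverse (g z)) \<longlongrightarrow> 0) (at p)"
    by (rule filterlim_compose[OF tendsto_inverse_0])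
  have "((\<lambda>z. c z + d z * inverse (g z)) \<longlongrightarrow> c p + d p * 0) (at p)"
    using cd by (intro tendsto_intros i0) (auto simp: isCont_def)
  hence "eventually (\<lambda>z. c z + d z * inverse (g z) \<noteq> 0) (at p)"
    using nz True by (intro tendsto_imp_eventually_ne) auto
  moreover have "eventually (\<lambda>z. g z \<noteq> 0) (at p)"
    using gi by (rule filterlim_at_infinity_imp_eventually_ne)
  ultimately show ?thesis
    by eventually_elim (auto simp: field_simps)
qed

text \<open>The determinant excludes a limit of the form 0/0. Where the denominator tends to 0,
  \<open>ev\<close> keeps it nonzero on the way, so that the quotient really tends to
  infinity.\<close>

lemma moebius_limit:
  fixes g a b c d :: "complex \<Rightarrow> complex" and N :: "complex^2^2"
  assumes g: "g nicely_meromorphic_on uhp" "p \<in> uhp"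
    and cont: "isCont a p" "isCont b p" "isCont c p" "isCont d p"
    and det: "a p * d p - b p * c p \<noteq> 0"
    and ev: "eventually (\<lambda>z. c z * g z + d z \<noteq> 0) (at p)"
    and N: "N$1$1 = a p" "N$1$2 = b p" "N$2$1 = c p" "N$2$2 = d p"
  defines "q \<equiv> (\<lambda>z. (a z * g z + b z) / (c z * g z + d z))"
  shows "sphere_act N (sphere_fun g p) = Some L \<Longrightarrow> q \<midarrow>p\<rightarrow> L"
    and "sphere_act N (sphere_fun g p) = None \<Longrightarrow> is_pole q p"
proof -
  have t: "a \<midarrow>p\<rightarrow> a p" "b \<midarrow>p\<rightarrow> b p" "c \<midarrow>p\<rightarrow> c p" "d \<midarrow>p\<rightarrow> d p"
    using cont by (simp_all add: isCont_def)
  have "(sphere_act N (sphere_fun g p) = Some L \<longrightarrow> q \<midarrow>p\<rightarrow> L) \<and>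
        (sphere_act N (sphere_fun g p) = None \<longrightarrow> is_pole q p)"
  proof (cases "is_pole g p")
    case False
    have tg: "g \<midarrow>p\<rightarrow> g p"
      using nicely_meromorphic_on_imp_analytic_at[OF g False] analytic_at_imp_isCont isCont_def by blast
    have u: "(\<lambda>z. a z * g z + b z) \<midarrow>p\<rightarrow> a p * g p + b p" by (intro tendsto_intros t tg)
    have v: "(\<lambda>z. c z * g z + d z) \<midarrow>p\<rightarrow> c p * g p + d p" by (intro tendsto_intros t tg)
    have sf: "sphere_fun g p = Some (g p)" using False g by (simp add: sphere_fun_def)
    show ?thesis
    proof (cases "c p * g p + d p = 0")
      case True
      \<comment> \<open>Eliminates \<open>g p\<close>: numerator and denominator cannot both
        vanish.\<close>
      have "a p * (c p * g p + d p) - c p * (a p * g p + b p) = a p * d p - b p * c p"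
        by (simp add: algebra_simps)
      hence "a p * g p + b p \<noteq> 0" using True det by auto
      hence "is_pole q p"
        unfolding is_pole_def q_def using v ev True
        by (intro filterlim_divide_at_infinity[OF u]) (auto simp: filterlim_at)
      thus ?thesis using True by (simp add: sf sphere_act_def N)
    next
      case False
      have "q \<midarrow>p\<rightarrow> (a p * g p + b p) / (c p * g p + d p)"
        unfolding q_def by (intro tendsto_divide u v False)
      thus ?thesis using False by (auto simp: sf sphere_act_def N moebius_def)
    qed
  next
    case True
    hence gi: "filterlim g at_infinity (at p)" by (simp add: is_pole_def)
    hence i0: "((\<lambda>z. inverse (g z)) \<longlongrightarrow> 0) (at p)"
      by (rule filterlim_compose[OF tendsto_inverse_0])
    have gnz: "eventually (\<lambda>z. g z \<noteq> 0) (at p)"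
      using gi by (rule filterlim_at_infinity_imp_eventually_ne)
    \<comment> \<open>The quotient in the chart at infinity; it agrees with \<open>q\<close> where
      \<open>g\<close> is nonzero, hence near the pole.\<close>
    define r where "r = (\<lambda>z. (a z + b z * inverse (g z)) / (c z + d z * inverse (g z)))"
    have qr: "eventually (\<lambda>z. r z = q z) (at p)"
      using gnz
    proof eventually_elim
      case (elim z)
      have "a z + b z * inverse (g z) = (a z * g z + b z) / g z"
        "c z + d z * inverse (g z) = (c z * g z + d z) / g z"
        using elim by (simp_all add: field_simps)
      thus ?case using elim by (simp add: r_def q_def)
    qed
    have "(\<lambda>z. a z + b z * inverse (g z)) \<midarrow>p\<rightarrow> a p + b p * 0" by (intro tendsto_intros t i0)
    hence u: "(\<lambda>z. a z + b z * inverse (g z)) \<midarrow>p\<rightarrow> a p" by simp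
    have "(\<lambda>z. c z + d z * inverse (g z)) \<midarrow>p\<rightarrow> c p + d p * 0" by (intro tendsto_intros t i0)
    hence v: "(\<lambda>z. c z + d z * inverse (g z)) \<midarrow>p\<rightarrow> c p" by simp
    have vnz: "eventually (\<lambda>z. c z + d z * inverse (g z) \<noteq> 0) (at p)"
      using ev gnz
    proof eventually_elim
      case (elim z)
      have "c z + d z * inverse (g z) = (c z * g z + d z) / g z"
        using elim by (simp add: field_simps)
      thus ?case using elim by simp
    qed
    have sf: "sphere_fun g p = None" using True g by (simp add: sphere_fun_def)
    show ?thesis
    proof (cases "c p = 0")
      case True
      hence "a p \<noteq> 0" using det by auto
      hence "filterlim r at_infinity (at p)"
        unfolding r_def using v vnz True
        by (intro filterlim_divide_at_infinity[OF u]) (auto simp: filterlim_at)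
      hence "is_pole q p"
        unfolding is_pole_def using filterlim_cong[OF refl refl qr] by blast
      thus ?thesis using True by (simp add: sf sphere_act_def N)
    next
      case False
      have "r \<midarrow>p\<rightarrow> a p / c p"
        unfolding r_def by (intro tendsto_divide u v False)
      hence "q \<midarrow>p\<rightarrow> a p / c p"
        using filterlim_cong[OF refl refl qr] by blast
      thus ?thesis using False by (auto simp: sf sphere_act_def N)
    qed
  qed
  thus "sphere_act N (sphere_fun g p) = Some L \<Longrightarrow> q \<midarrow>p\<rightarrow> L"
    and "sphere_act N (sphere_fun g p) = None \<Longrightarrow> is_pole q p" by blast+
qed

text \<open>On the connected half-plane the meromorphic denominator vanishes off a sparse set or is
  nonzero off one. A single finite image value, supplied by \<open>fin\<close>, excludes the former;
  then limits give the sphere value everywhere.\<close>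

lemma sphere_act_in_mero_uhp:
  fixes N :: "complex \<Rightarrow> complex^2^2"
  assumes f: "f \<in> mero_uhp"
    and holo: "\<And>i j. (\<lambda>\<tau>. N \<tau> $ i $ j) holomorphic_on uhp"
    and det: "\<And>\<tau>. \<tau> \<in> uhp \<Longrightarrow> det (N \<tau>) \<noteq> 0"
    and fin: "\<exists>\<tau>\<in>uhp. sphere_act (N \<tau>) (f \<tau>) \<noteq> None"
  shows "(\<lambda>\<tau>\<in>uhp. sphere_act (N \<tau>) (f \<tau>)) \<in> mero_uhp"
proof -
  obtain g where g: "g nicely_meromorphic_on uhp" and fg: "f = sphere_fun g"
    using f by (auto simp: mero_uhp_def)
  have gm: "g meromorphic_on uhp" using g by (simp add: nicely_meromorphic_on_def)
  have ana: "(\<lambda>\<tau>. N \<tau> $ i $ j) analytic_on uhp" for i j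
    using holo open_uhp by (simp add: analytic_on_open)
  have mero: "(\<lambda>\<tau>. N \<tau> $ i $ j) meromorphic_on uhp" for i j
    by (rule analytic_on_imp_meromorphic_on[OF ana])
  have cont: "isCont (\<lambda>\<tau>. N \<tau> $ i $ j) p" if "p \<in> uhp" for i j p
    using ana that analytic_at_imp_isCont analytic_on_analytic_at by blast
  define u where "u = (\<lambda>z. N z $1$1 * g z + N z $1$2)"
  define v where "v = (\<lambda>z. N z $2$1 * g z + N z $2$2)"
  define q where "q = (\<lambda>z. u z / v z)"
  have vm: "v meromorphic_on uhp" unfolding v_def by (intro meromorphic_intros mero gm)
  have qm: "q meromorphic_on uhp" unfolding q_def u_def v_def by (intro meromorphic_intros mero gm)
  have "\<not> eventually (\<lambda>z. v z = 0) (cosparse uhp)"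
  proof
    assume *: "eventually (\<lambda>z. v z = 0) (cosparse uhp)"
    obtain p where p: "p \<in> uhp" "sphere_act (N p) (f p) \<noteq> None" using fin by blast
    have "eventually (\<lambda>z. v z = 0) (at p)"
      using * p open_uhp by (simp add: eventually_cosparse_open_eq)
    moreover have "eventually (\<lambda>z. v z \<noteq> 0) (at p)"
      unfolding v_def
    proof (rule eventually_moebius_denom_nz[OF g p(1) cont[OF p(1)] cont[OF p(1)]])
      show "if is_pole g p then N p $2$1 \<noteq> 0 else N p $2$1 * g p + N p $2$2 \<noteq> 0"
        using p by (auto simp: fg sphere_fun_def sphere_act_def)
    qed
    ultimately have "eventually (\<lambda>z. False) (at p)" by eventually_elim simp
    thus False by simp
  qed
  hence "eventually (\<lambda>z. v z \<noteq> 0) (cosparse uhp)"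
    using meromorphic_imp_constant_or_avoid[OF vm open_uhp connected_uhp] by blast
  hence ev: "eventually (\<lambda>z. v z \<noteq> 0) (at p)" if "p \<in> uhp" for p
    using that open_uhp by (simp add: eventually_cosparse_open_eq)
  have "(\<lambda>\<tau>\<in>uhp. sphere_act (N \<tau>) (f \<tau>)) = sphere_fun (remove_sings q)"
  proof
    fix p
    show "(\<lambda>\<tau>\<in>uhp. sphere_act (N \<tau>) (f \<tau>)) p = sphere_fun (remove_sings q) p"
    proof (cases "p \<in> uhp")
      case False
      thus ?thesis by (simp add: sphere_fun_def)
    next
      case True
      have det': "N p $1$1 * N p $2$2 - N p $1$2 * N p $2$1 \<noteq> 0"
        using det[OF True] by (simp add: det_2)
      note lim = moebius_limit[OF g True cont[OF True] cont[OF True] cont[OF True] cont[OF True] det'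
          ev[OF True, unfolded v_def] refl refl refl refl, folded fg]
      have q_eq: "q = (\<lambda>z. (N z $1$1 * g z + N z $1$2) / (N z $2$1 * g z + N z $2$2))"
        by (simp add: q_def u_def v_def)
      have "isolated_singularity_at q p"
        using qm True by (meson meromorphic_on_isolated_singularity meromorphic_on_meromorphic_at)
      from sphere_fun_eqI[OF True this lim[folded q_eq]] show ?thesis using True by simp
    qed
  qed
  moreover have "remove_sings q nicely_meromorphic_on uhp"
    by (rule remove_sings_nicely_meromorphic[OF qm])
  ultimately show ?thesis by (auto simp: mero_uhp_def)
qed

text \<open>Poles do not accumulate at \<open>\<i>\<close>, which is an arbitrary choice of
  point.\<close>

lemma mero_uhp_finite_somewhere:
  assumes "f \<in> mero_uhp"
  shows "\<exists>\<tau>\<in>uhp. f \<tau> \<noteq> None"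
proof -
  obtain g where g: "g nicely_meromorphic_on uhp" and fg: "f = sphere_fun g"
    using assms by (auto simp: mero_uhp_def)
  have i: "\<i> \<in> uhp" by (simp add: uhp_def)
  have "isolated_singularity_at g \<i>"
    using g i by (meson meromorphic_on_isolated_singularity meromorphic_on_meromorphic_at nicely_meromorphic_on_def)
  hence "eventually (\<lambda>w. \<not> is_pole g w) (at \<i>)" by (rule eventually_not_pole)
  moreover have "eventually (\<lambda>w. w \<in> uhp) (at \<i>)" using open_uhp i by (rule eventually_at_in_open')
  ultimately have "eventually (\<lambda>w. w \<in> uhp \<and> \<not> is_pole g w) (at \<i>)" by eventually_elim simp
  hence "\<exists>w. w \<in> uhp \<and> \<not> is_pole g w" by (rule eventually_happens'[OF at_neq_bot])
  thus ?thesis by (auto simp: fg sphere_fun_def)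
qed

lemma mero_uhp_undefined: "f \<in> mero_uhp \<Longrightarrow> \<tau> \<notin> uhp \<Longrightarrow> f \<tau> = undefined"
  by (auto simp: mero_uhp_def sphere_fun_def)

section \<open>Equivariance\<close>

abbreviation (input) SL2_act :: "int^2^2 \<Rightarrow> complex \<Rightarrow> complex" where
  "SL2_act \<gamma> \<tau> \<equiv> point_act (map_matrix of_int \<gamma>) \<tau>"

section \<open>The modular group acting on points, lattices and quasi-periods\<close>

lemma SL2_factor_nz:
  fixes \<gamma> :: "int^2^2"
  assumes "\<gamma> \<in> SL2Z" "\<tau> \<in> uhp"
  shows "of_int (\<gamma>$2$1) * \<tau> + of_int (\<gamma>$2$2) \<noteq> 0"
proof
  assume *: "of_int (\<gamma>$2$1) * \<tau> + of_int (\<gamma>$2$2) = 0"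
  hence "\<gamma>$2$1 = 0" using assms by (auto simp: complex_eq_iff uhp_def)
  moreover from this have "\<gamma>$2$2 = 0" using * by simp
  ultimately show False using assms by (simp add: SL2Z_def det_2)
qed

lemma SL2_act_in_uhp:
  fixes \<gamma> :: "int^2^2"
  assumes "\<gamma> \<in> SL2Z" "\<tau> \<in> uhp"
  shows "SL2_act \<gamma> \<tau> \<in> uhp"
proof -
  define a b c d where "a = real_of_int (\<gamma>$1$1)" "b = real_of_int (\<gamma>$1$2)"
    "c = real_of_int (\<gamma>$2$1)" "d = real_of_int (\<gamma>$2$2)"
  note abcd = this
  define j where "j = of_int (\<gamma>$2$1) * \<tau> + of_int (\<gamma>$2$2)"
  have "\<gamma>$1$1 * \<gamma>$2$2 - \<gamma>$1$2 * \<gamma>$2$1 = 1" using assms by (simp add: SL2Z_def det_2)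
  hence det: "a * d - b * c = 1" unfolding abcd by (metis of_int_1 of_int_diff of_int_mult)
  have "j \<noteq> 0" using SL2_factor_nz[OF assms] by (simp add: j_def)
  have "Im (SL2_act \<gamma> \<tau>) = (a * d - b * c) * Im \<tau> / ((Re j)^2 + (Im j)^2)"
    by (simp add: moebius_def Im_divide j_def abcd algebra_simps)
  also have "\<dots> > 0"
    unfolding det using assms \<open>j \<noteq> 0\<close> by (auto simp: uhp_def complex_eq_iff sum_power2_gt_zero_iff)
  finally show ?thesis by (simp add: uhp_def)
qed

text \<open>The moved point and 1 are \<open>1 / j\<close> times another integral basis of the same
  lattice.\<close>

lemma period_lattice_SL2_act:
  fixes \<gamma> :: "int^2^2"
  assumes "\<gamma> \<in> SL2Z" "\<tau> \<in> uhp"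
  defines "j \<equiv> of_int (\<gamma>$2$1) * \<tau> + of_int (\<gamma>$2$2)"
  shows "period_lattice (SL2_act \<gamma> \<tau>) = (*) (1 / j) ` period_lattice \<tau>"
proof -
  define a b c d where "a = \<gamma>$1$1" "b = \<gamma>$1$2" "c = \<gamma>$2$1" "d = \<gamma>$2$2"
  note abcd = this
  have det: "a * d - b * c = 1" using assms by (simp add: SL2Z_def det_2 abcd)
  have j: "j \<noteq> 0" using SL2_factor_nz[OF assms(1,2)] by (simp add: j_def)
  have g: "SL2_act \<gamma> \<tau> = (of_int a * \<tau> + of_int b) / j"
    by (simp add: moebius_def j_def abcd)
  have eq: "of_int m + of_int n * SL2_act \<gamma> \<tau> =
      1 / j * (of_int (m * d + n * b) + of_int (m * c + n * a) * \<tau>)" for m n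
    unfolding g using j by (simp add: field_simps) (simp add: j_def abcd algebra_simps)
  show ?thesis
  proof (intro equalityI subsetI)
    fix x assume "x \<in> period_lattice (SL2_act \<gamma> \<tau>)"
    then obtain m n where "x = of_int m + of_int n * SL2_act \<gamma> \<tau>"
      by (auto simp: period_lattice_def)
    thus "x \<in> (*) (1 / j) ` period_lattice \<tau>"
      unfolding eq using period_lattice_memI by blast
  next
    fix x assume "x \<in> (*) (1 / j) ` period_lattice \<tau>"
    then obtain k l where x: "x = 1 / j * (of_int k + of_int l * \<tau>)"
      by (auto simp: period_lattice_def)
    \<comment> \<open>Coordinates under the inverse base change, which is integral since the
      determinant is 1.\<close>
    define m n where "m = a * k - b * l" "n = d * l - c * k"
    note mn = this
    have "m * d + n * b = (a * d - b * c) * k" "m * c + n * a = (a * d - b * c) * l"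
      by (simp_all add: mn algebra_simps)
    hence "x = of_int m + of_int n * SL2_act \<gamma> \<tau>"
      unfolding eq x det by simp
    thus "x \<in> period_lattice (SL2_act \<gamma> \<tau>)" by (auto simp: period_lattice_def)
  qed
qed

text \<open>Shrinking the lattice by \<open>1 / j\<close> multiplies quasi-periods by
  \<open>j\<close>; linearity then evaluates them at the two rows of
  \<open>\<gamma>\<close>.\<close>

lemma quasi_period_SL2_act:
  fixes \<gamma> :: "int^2^2"
  assumes "\<gamma> \<in> SL2Z" "\<tau> \<in> uhp"
  defines "j \<equiv> of_int (\<gamma>$2$1) * \<tau> + of_int (\<gamma>$2$2)"
  defines "\<eta> \<equiv> quasi_period (period_lattice \<tau>)" and "\<eta>' \<equiv> quasi_period (period_lattice (SL2_act \<gamma> \<tau>))"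
  shows "\<eta>' (SL2_act \<gamma> \<tau>) = j * (of_int (\<gamma>$1$1) * \<eta> \<tau> + of_int (\<gamma>$1$2) * \<eta> 1)"
    and "\<eta>' 1 = j * (of_int (\<gamma>$2$1) * \<eta> \<tau> + of_int (\<gamma>$2$2) * \<eta> 1)"
proof -
  have j: "j \<noteq> 0" using SL2_factor_nz[OF assms(1,2)] by (simp add: j_def)
  have t: "Im \<tau> > 0" using assms by (simp add: uhp_def)
  have t': "Im (SL2_act \<gamma> \<tau>) > 0" using SL2_act_in_uhp[OF assms(1,2)] by (simp add: uhp_def)
  have L: "(*) (1 / j) ` period_lattice \<tau> = period_lattice (SL2_act \<gamma> \<tau>)"
    unfolding j_def by (rule period_lattice_SL2_act[OF assms(1,2), symmetric])
  have *: "\<eta>' ((1 / j) * (of_int a * \<tau> + of_int b)) = (of_int a * \<eta> \<tau> + of_int b * \<eta> 1) / (1 / j)" for a b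
    unfolding \<eta>'_def \<eta>_def using j
    by (intro quasi_period_eqI[OF is_quasi_period_scale[OF quasi_period_linear[OF t], of "1 / j", unfolded L]
            half_notin_period_lattice(1)[OF t']]) auto
  have "SL2_act \<gamma> \<tau> = (1 / j) * (of_int (\<gamma>$1$1) * \<tau> + of_int (\<gamma>$1$2))"
    by (simp add: moebius_def j_def)
  thus "\<eta>' (SL2_act \<gamma> \<tau>) = j * (of_int (\<gamma>$1$1) * \<eta> \<tau> + of_int (\<gamma>$1$2) * \<eta> 1)"
    by (simp only: *) simp
  have "1 = (1 / j) * (of_int (\<gamma>$2$1) * \<tau> + of_int (\<gamma>$2$2))"
    using j by (simp add: j_def)
  thus "\<eta>' 1 = j * (of_int (\<gamma>$2$1) * \<eta> \<tau> + of_int (\<gamma>$2$2) * \<eta> 1)"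
    using *[of "\<gamma>$2$1" "\<gamma>$2$2"] by simp
qed

section \<open>Transformation behaviour of the matrix M\<close>

lemma det_M_mat:
  assumes "\<tau> \<in> uhp"
  shows "det (M_mat \<tau>) = 2 * of_real pi * \<i>"
  using legendre_relation[of \<tau>] assms by (simp add: M_mat_def det_2 uhp_def)

lemma det_M_mat_nz: "\<tau> \<in> uhp \<Longrightarrow> det (M_mat \<tau>) \<noteq> 0"
  by (simp add: det_M_mat)

lemma holomorphic_M_mat: "(\<lambda>\<tau>. M_mat \<tau> $ i $ j) holomorphic_on uhp"
  using exhaust_2[of i] exhaust_2[of j]
  by (auto simp: M_mat_def intro!: holomorphic_intros holomorphic_quasi_period_one holomorphic_quasi_period_tau)

text \<open>The first column is the base change of the periods, the second that of the
  quasi-periods. They scale by inverse factors, whence the two diagonal entries.\<close>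

lemma M_mat_SL2_act:
  fixes \<gamma> :: "int^2^2"
  assumes "\<gamma> \<in> SL2Z" "\<tau> \<in> uhp"
  defines "j \<equiv> of_int (\<gamma>$2$1) * \<tau> + of_int (\<gamma>$2$2)"
  shows "M_mat (SL2_act \<gamma> \<tau>) ** vector [vector [j, 0], vector [0, 1 / j]] = map_matrix of_int \<gamma> ** M_mat \<tau>"
proof -
  have j: "j \<noteq> 0" using SL2_factor_nz[OF assms(1,2)] by (simp add: j_def)
  have "SL2_act \<gamma> \<tau> * j = of_int (\<gamma>$1$1) * \<tau> + of_int (\<gamma>$1$2)"
    using j by (simp add: moebius_def j_def)
  thus ?thesis
    using j quasi_period_SL2_act[OF assms(1,2)]
    by (simp add: vec_eq_iff forall_2 matrix_mult_2_nth M_mat_def flip: j_def)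
qed

text \<open>Serves both directions: it turns weight 2 into equivariance and, after
  \<open>M_mat\<close> at the moved point is cancelled, equivariance into weight 2.\<close>

lemma sphere_act_M_mat_SL2_act:
  fixes \<gamma> :: "int^2^2"
  assumes "\<gamma> \<in> SL2Z" "\<tau> \<in> uhp"
  shows "sphere_act (M_mat (SL2_act \<gamma> \<tau>))
           (map_option (\<lambda>w. (of_int (\<gamma>$2$1) * \<tau> + of_int (\<gamma>$2$2))^2 * w) w) =
         sphere_act (map_matrix of_int \<gamma>) (sphere_act (M_mat \<tau>) w)"
proof -
  define j where "j = of_int (\<gamma>$2$1) * \<tau> + of_int (\<gamma>$2$2)"
  define J :: "complex^2^2" where "J = vector [vector [j, 0], vector [0, 1 / j]]"
  have j: "j \<noteq> 0" using SL2_factor_nz[OF assms(1,2)] by (simp add: j_def)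
  have "map_option (\<lambda>w. j^2 * w) w = sphere_act J w"
    using j by (cases w) (simp_all add: sphere_act_def J_def moebius_def power2_eq_square)
  moreover have "det J \<noteq> 0" using j by (simp add: J_def det_2)
  ultimately show ?thesis
    using M_mat_SL2_act[OF assms] det_M_mat_nz[OF assms(2)]
    by (simp flip: sphere_act_mult j_def J_def)
qed

section \<open>The two mutually inverse maps\<close>

lemma M_inv_map_M_map:
  assumes "f \<in> mero_uhp"
  shows "M_inv_map (M_map f) = f"
  using mero_uhp_undefined[OF assms]
  by (auto simp: fun_eq_iff M_inv_map_def M_map_def restrict_def sphere_act_matrix_inv_cancel det_M_mat_nz)

lemma M_map_M_inv_map:
  assumes "f \<in> mero_uhp"
  shows "M_map (M_inv_map f) = f"
  using mero_uhp_undefined[OF assms]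
  by (auto simp: fun_eq_iff M_inv_map_def M_map_def restrict_def sphere_act_matrix_inv_cancel det_M_mat_nz)

lemma M_map_in_equivariant_funs:
  assumes "f \<in> M2_SL2Z"
  shows "M_map f \<in> equivariant_funs"
proof -
  have f: "f \<in> mero_uhp" using assms by (simp add: M2_SL2Z_def)
  have equiv: "M_map f (SL2_act \<gamma> \<tau>) = sphere_act (map_matrix of_int \<gamma>) (M_map f \<tau>)"
    if "\<gamma> \<in> SL2Z" "\<tau> \<in> uhp" for \<gamma> :: "int^2^2" and \<tau>
  proof -
    have "f (SL2_act \<gamma> \<tau>) = map_option (\<lambda>w. (of_int (\<gamma>$2$1) * \<tau> + of_int (\<gamma>$2$2))^2 * w) (f \<tau>)"
      using assms that unfolding M2_SL2Z_def by blast
    thus ?thesis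
      using sphere_act_M_mat_SL2_act[OF that, of "f \<tau>"] SL2_act_in_uhp[OF that] that
      by (simp add: M_map_def)
  qed
  have "\<exists>\<tau>\<in>uhp. sphere_act (M_mat \<tau>) (f \<tau>) \<noteq> None"
  proof (rule ccontr)
    assume "\<not> ?thesis"
    hence none: "M_map f \<tau> = None" if "\<tau> \<in> uhp" for \<tau> using that by (simp add: M_map_def)
    txt \<open>The inversion \<^term>\<open>S\<close> sends infinity to 0, so the constant infinity is not equivariant.\<close>
    define S :: "int^2^2" where "S = vector [vector [0, -1], vector [1, 0]]"
    have S: "S \<in> SL2Z" by (simp add: S_def SL2Z_def det_2)
    have i: "\<i> \<in> uhp" by (simp add: uhp_def)
    have "sphere_act (map_matrix of_int S) None = None"
      using equiv[OF S i] none[OF i] none[OF SL2_act_in_uhp[OF S i]] by simp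
    thus False by (simp add: sphere_act_def S_def)
  qed
  hence mero: "M_map f \<in> mero_uhp"
    unfolding M_map_def by (intro sphere_act_in_mero_uhp f holomorphic_M_mat det_M_mat_nz)
  have "M_map f \<noteq> (\<lambda>\<tau>\<in>uhp. Some \<tau>)"
  proof
    \<comment> \<open>At a point where \<open>f\<close> is finite this contradicts injectivity,
      because infinity has the same image.\<close>
    assume *: "M_map f = (\<lambda>\<tau>\<in>uhp. Some \<tau>)"
    obtain \<tau> where t: "\<tau> \<in> uhp" "f \<tau> \<noteq> None" using mero_uhp_finite_somewhere[OF f] by blast
    have "sphere_act (M_mat \<tau>) (f \<tau>) = M_map f \<tau>" using t by (simp add: M_map_def)
    also have "\<dots> = sphere_act (M_mat \<tau>) None"
      using t by (simp add: * sphere_act_def M_mat_def)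
    finally have "f \<tau> = None"
      using sphere_act_matrix_inv_cancel(1)[OF det_M_mat_nz[OF t(1)]] by metis
    with t show False by simp
  qed
  thus ?thesis using mero equiv by (simp add: equivariant_funs_def)
qed

lemma M_inv_map_in_M2_SL2Z:
  assumes "h \<in> equivariant_funs"
  shows "M_inv_map h \<in> M2_SL2Z"
proof -
  have h: "h \<in> mero_uhp" and h_id: "h \<noteq> (\<lambda>\<tau>\<in>uhp. Some \<tau>)"
    using assms by (simp_all add: equivariant_funs_def)
  \<comment> \<open>The adjugate takes the place of the inverse because meromorphy of the image is
    proved for holomorphic entries.\<close>
  have inv_eq: "M_inv_map h = (\<lambda>\<tau>\<in>uhp. sphere_act (adjugate2 (M_mat \<tau>)) (h \<tau>))"
    by (auto simp: M_inv_map_def restrict_def fun_eq_iff sphere_act_matrix_inv det_M_mat_nz)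
  have "\<exists>\<tau>\<in>uhp. sphere_act (adjugate2 (M_mat \<tau>)) (h \<tau>) \<noteq> None"
  proof (rule ccontr)
    \<comment> \<open>A preimage that is infinite everywhere would make \<open>h\<close> the
      excluded identity.\<close>
    assume *: "\<not> ?thesis"
    have "h \<tau> = Some \<tau>" if "\<tau> \<in> uhp" for \<tau>
    proof -
      have "sphere_act (matrix_inv (M_mat \<tau>)) (h \<tau>) = None"
        using * that by (simp add: sphere_act_matrix_inv det_M_mat_nz)
      hence "h \<tau> = sphere_act (M_mat \<tau>) None"
        using sphere_act_matrix_inv_cancel(2)[OF det_M_mat_nz[OF that]] by metis
      thus ?thesis by (simp add: sphere_act_def M_mat_def)
    qed
    hence "h = (\<lambda>\<tau>\<in>uhp. Some \<tau>)"
      using mero_uhp_undefined[OF h] by (auto simp: fun_eq_iff restrict_def)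
    with h_id show False by simp
  qed
  moreover have "(\<lambda>\<tau>. adjugate2 (M_mat \<tau>) $ i $ j) holomorphic_on uhp" for i j
    using exhaust_2[of i] exhaust_2[of j]
    by (auto simp: adjugate2_def intro!: holomorphic_intros holomorphic_M_mat)
  ultimately have mero: "M_inv_map h \<in> mero_uhp"
    unfolding inv_eq by (intro sphere_act_in_mero_uhp h) (auto simp: det_adjugate2 det_M_mat_nz)
  have "M_inv_map h (SL2_act \<gamma> \<tau>) =
     map_option (\<lambda>w. (of_int (\<gamma>$2$1) * \<tau> + of_int (\<gamma>$2$2))^2 * w) (M_inv_map h \<tau>)"
    if g: "\<gamma> \<in> SL2Z" "\<tau> \<in> uhp" for \<gamma> :: "int^2^2" and \<tau>
  proof -
    have g': "SL2_act \<gamma> \<tau> \<in> uhp" by (rule SL2_act_in_uhp[OF g])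
    have "h \<tau> = sphere_act (M_mat \<tau>) (M_inv_map h \<tau>)"
      using g by (simp add: M_inv_map_def sphere_act_matrix_inv_cancel det_M_mat_nz)
    moreover have "h (SL2_act \<gamma> \<tau>) = sphere_act (map_matrix of_int \<gamma>) (h \<tau>)"
      using assms g unfolding equivariant_funs_def by blast
    \<comment> \<open>With \<open>h\<close> at the moved point in the form \<open>M_mat\<close>
      applied to a value, the inverse matrix there recovers that value.\<close>
    ultimately have "h (SL2_act \<gamma> \<tau>) = sphere_act (M_mat (SL2_act \<gamma> \<tau>))
      (map_option (\<lambda>w. (of_int (\<gamma>$2$1) * \<tau> + of_int (\<gamma>$2$2))^2 * w) (M_inv_map h \<tau>))"
      by (simp only: sphere_act_M_mat_SL2_act[OF g])
    moreover have "M_inv_map h (SL2_act \<gamma> \<tau>) =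
        sphere_act (matrix_inv (M_mat (SL2_act \<gamma> \<tau>))) (h (SL2_act \<gamma> \<tau>))"
      using g' by (simp only: M_inv_map_def restrict_apply' if_True)
    ultimately show ?thesis
      by (simp only: sphere_act_matrix_inv_cancel(1)[OF det_M_mat_nz[OF g']])
  qed
  thus ?thesis using mero by (simp add: M2_SL2Z_def)
qed

theorem theorem5p2:
  shows "bij_betw M_map M2_SL2Z equivariant_funs \<and>
         (\<forall>h\<in>equivariant_funs. inv_into M2_SL2Z M_map h = M_inv_map h)"
proof -
  have left: "M_inv_map (M_map f) = f" if "f \<in> M2_SL2Z" for f
    using that M_inv_map_M_map by (simp add: M2_SL2Z_def)
  have right: "M_map (M_inv_map h) = h" if "h \<in> equivariant_funs" for h
    using that M_map_M_inv_map by (simp add: equivariant_funs_def)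
  have "bij_betw M_map M2_SL2Z equivariant_funs"
    by (rule bij_betw_byWitness[where f' = M_inv_map])
       (auto simp: left right M_map_in_equivariant_funs M_inv_map_in_M2_SL2Z)
  moreover from this have "inv_into M2_SL2Z M_map h = M_inv_map h" if "h \<in> equivariant_funs" for h
    using that by (intro inv_into_f_eq M_inv_map_in_M2_SL2Z right) (auto simp: bij_betw_def)
  ultimately show ?thesis by blast
qed

end
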